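(* Let $T\ge3$, let $F:\mathbb{R}^d\to\mathbb{R}$ be lower bounded by $F^*$ with $\Delta_1\ge F(x_1)-F^*$, let $F$ be $L$-smooth, and let the gradient oracle satisfy the $p$-BCM assumption with $p\in(1,2]$ and constant $\sigma\ge0$. Let $\eta>0$. Then the iterates generated by NSGD with $g_t=\beta_tg_{t-1}+(1-\beta_t)\nabla f(x_t,\xi_t)$ and parameters $\beta_t=1-t^{-1/2}$ and $\eta_t=\eta t^{-3/4}$ satisfy $$\frac1T\sum_{t=1}^T\mathbb{E}\big[\|\nabla F(x_t)\|\big]\le\frac{\frac{\Delta_1}{\eta}+120\,\eta L\log(T)+120\,\sigma\,\frac{4p}{2-p}\Big(T^{\frac{2-p}{4p}}-1\Big)}{T^{1/4}}.$$ In particular, this corresponds to a rate of convergence of $\widetilde{\mathcal{O}}\big((\Delta_1+L)T^{-1/4}+\sigma T^{-\frac{p-1}{2p}}\big)$ and hence a sample complexity of $\widetilde{\mathcal{O}}\Big(\frac{\Delta_1^4+L^4}{\varepsilon^4}+\big(\frac{\sigma}{\varepsilon}\big)^{\frac{2p}{p-1}}\Big)$.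
   Context: Assumptions. (Lower boundedness) $F\ge F^*>-\infty$ on $\mathbb{R}^d$, and $\Delta_1\ge F(x_1)-F^*$ is a given upper bound on the initialization gap. ($L$-smoothness) $F$ is differentiable and $\|\nabla F(x)-\nabla F(y)\|\le L\|x-y\|$ for all $x,y\in\mathbb{R}^d$, where $L\ge0$. ($p$-BCM) for all $x\in\mathbb{R}^d$: $\mathbb{E}[\nabla f(x,\xi)]=\nabla F(x)$ and $\mathbb{E}[\|\nabla f(x,\xi)-\nabla F(x)\|^p]\le\sigma^p$, where $\nabla f(\cdot,\xi)$ is the stochastic gradient oracle. NSGD: from a deterministic initial point $x_1$, iterate $x_{t+1}=x_t-\eta_t\,g_t/\|g_t\|$, with the convention $g/\|g\|:=0$ if $g=0$. Here $g_0=0$ and $\xi_1,\xi_2,\dots$ are independent copies of $\xi$; one oracle call is used per iteration. For $p=2$ the expression $\frac{4p}{2-p}\big(T^{\frac{2-p}{4p}}-1\big)$ is understood by continuous extension, i.e. as $\log T$. Sample complexity: the number of oracle calls sufficient to guarantee $\frac1T\sum_{t=1}^T\mathbb{E}[\|\nabla F(x_t)\|]\le\varepsilon$. The notation $\widetilde{\mathcal{O}}$ hides constants depending only on $\eta,p$ and poly-logarithmic factors in $T$ (respectively in $1/\varepsilon$), for large $T$ (respectively, with $\Delta_1>0$, for sufficiently small $\varepsilon>0$, the threshold possibly depending on $\Delta_1,L,\sigma,\eta,p$). *)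

theory Defs
  imports "HOL-Probability.Probability"
begin

definition gradient :: "('a::euclidean_space \<Rightarrow> real) \<Rightarrow> 'a \<Rightarrow> 'a" where
  "gradient F x = (THE D. GDERIV F x :> D)"

definition L_smooth :: "real \<Rightarrow> ('a::euclidean_space \<Rightarrow> real) \<Rightarrow> bool" where
  "L_smooth L F \<longleftrightarrow> (\<forall>x. F differentiable (at x)) \<and> L-lipschitz_on UNIV (gradient F)"

(* D is the law of xi and df the oracle.  Joint measurability of df makes df (x_t) (xi_t) a
   random variable for random x_t.  The integrability conditions keep the Bochner integrals
   from taking their default value 0. *)
definition p_BCM ::
  "real \<Rightarrow> real \<Rightarrow> 'xi measure \<Rightarrow> ('a::euclidean_space \<Rightarrow> 'xi \<Rightarrow> 'a) \<Rightarrow> ('a \<Rightarrow> real) \<Rightarrow> bool" where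
  "p_BCM p \<sigma> D df F \<longleftrightarrow>
     prob_space D \<and> 0 \<le> \<sigma> \<and>
     case_prod df \<in> borel_measurable (borel \<Otimes>\<^sub>M D) \<and>
     (\<forall>x. integrable D (df x) \<and> (\<integral>s. df x s \<partial>D) = gradient F x \<and>
          integrable D (\<lambda>s. norm (df x s - gradient F x) powr p) \<and>
          (\<integral>s. norm (df x s - gradient F x) powr p \<partial>D) \<le> \<sigma> powr p)"

definition iid_samples :: "'w measure \<Rightarrow> 'xi measure \<Rightarrow> (nat \<Rightarrow> 'w \<Rightarrow> 'xi) \<Rightarrow> bool" where
  "iid_samples M D \<xi> \<longleftrightarrow>
     prob_space M \<and> prob_space.indep_vars M (\<lambda>_. D) \<xi> {1..} \<and> (\<forall>t\<ge>1. distr M D (\<xi> t) = D)"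

(* sgn v = v / norm v, with sgn 0 = 0.  The value of x at index 0 is irrelevant. *)
definition nsgd_iterates ::
  "(nat \<Rightarrow> real) \<Rightarrow> (nat \<Rightarrow> real) \<Rightarrow> 'w measure \<Rightarrow> (nat \<Rightarrow> 'w \<Rightarrow> 'xi) \<Rightarrow>
   ('a::euclidean_space \<Rightarrow> 'xi \<Rightarrow> 'a) \<Rightarrow> 'a \<Rightarrow> (nat \<Rightarrow> 'w \<Rightarrow> 'a) \<Rightarrow> (nat \<Rightarrow> 'w \<Rightarrow> 'a) \<Rightarrow> bool" where
  "nsgd_iterates \<beta> \<eta> M \<xi> df x1 x g \<longleftrightarrow>
     (\<forall>\<omega>\<in>space M. x 1 \<omega> = x1 \<and> g 0 \<omega> = 0 \<and>
        (\<forall>t\<ge>1. g t \<omega> = \<beta> t *\<^sub>R g (t - 1) \<omega> + (1 - \<beta> t) *\<^sub>R df (x t \<omega>) (\<xi> t \<omega>) \<and>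
                x (t + 1) \<omega> = x t \<omega> - \<eta> t *\<^sub>R sgn (g t \<omega>)))"

definition nsgd_run ::
  "real \<Rightarrow> real \<Rightarrow> real \<Rightarrow> real \<Rightarrow> real \<Rightarrow> 'w measure \<Rightarrow> 'xi measure \<Rightarrow> (nat \<Rightarrow> 'w \<Rightarrow> 'xi) \<Rightarrow>
   ('a::euclidean_space \<Rightarrow> 'xi \<Rightarrow> 'a) \<Rightarrow> ('a \<Rightarrow> real) \<Rightarrow> real \<Rightarrow> 'a \<Rightarrow>
   (nat \<Rightarrow> 'w \<Rightarrow> 'a) \<Rightarrow> (nat \<Rightarrow> 'w \<Rightarrow> 'a) \<Rightarrow> bool" where
  "nsgd_run \<eta> p \<Delta>\<^sub>1 L \<sigma> M D \<xi> df F Fstar x1 x g \<longleftrightarrow>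
     (\<forall>y. Fstar \<le> F y) \<and> F x1 - Fstar \<le> \<Delta>\<^sub>1 \<and>
     L_smooth L F \<and> p_BCM p \<sigma> D df F \<and> iid_samples M D \<xi> \<and>
     nsgd_iterates (\<lambda>t. 1 - real t powr (-1/2)) (\<lambda>t. \<eta> * real t powr (-3/4)) M \<xi> df x1 x g"

definition avg_grad_norm ::
  "'w measure \<Rightarrow> ('a::euclidean_space \<Rightarrow> real) \<Rightarrow> (nat \<Rightarrow> 'w \<Rightarrow> 'a) \<Rightarrow> nat \<Rightarrow> real" where
  "avg_grad_norm M F x T = (1 / real T) * (\<Sum>t=1..T. \<integral>\<omega>. norm (gradient F (x t \<omega>)) \<partial>M)"

(* the value at p = 2 is the limit for p tending to 2 *)
definition noise_growth :: "real \<Rightarrow> real \<Rightarrow> real" where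
  "noise_growth p T =
     (if p = 2 then ln T else 4 * p / (2 - p) * (T powr ((2 - p) / (4 * p)) - 1))"

definition nsgd_bound :: "real \<Rightarrow> real \<Rightarrow> real \<Rightarrow> real \<Rightarrow> real \<Rightarrow> nat \<Rightarrow> real" where
  "nsgd_bound \<eta> p \<Delta>\<^sub>1 L \<sigma> T =
     (\<Delta>\<^sub>1 / \<eta> + 120 * \<eta> * L * ln (real T) + 120 * \<sigma> * noise_growth p (real T)) / real T powr (1/4)"

(* C and k are the hidden constant and the exponent of the hidden logarithm; they must be
   chosen from \<eta> and p alone.  HOL cannot place them before the type variables (dimension and
   probability spaces), so each estimate below is asserted both for the runs and for nsgd_bound,
   which involves no type variable and dominates the runs: constants valid for nsgd_bound
   are the same for all dimensions and all probability spaces. *)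

definition soft_rate :: "real \<Rightarrow> nat \<Rightarrow> real \<Rightarrow> real \<Rightarrow> real \<Rightarrow> real \<Rightarrow> nat \<Rightarrow> real" where
  "soft_rate C k p \<Delta>\<^sub>1 L \<sigma> T =
     C * ln (real T) ^ k *
       ((\<Delta>\<^sub>1 + L) * real T powr (-1/4) + \<sigma> * real T powr (- (p - 1) / (2 * p)))"

definition soft_complexity :: "real \<Rightarrow> nat \<Rightarrow> real \<Rightarrow> real \<Rightarrow> real \<Rightarrow> real \<Rightarrow> real \<Rightarrow> real" where
  "soft_complexity C k p \<Delta>\<^sub>1 L \<sigma> \<epsilon> =
     C * ln (1 / \<epsilon>) ^ k *
       ((\<Delta>\<^sub>1 ^ 4 + L ^ 4) / \<epsilon> ^ 4 + (\<sigma> / \<epsilon>) powr (2 * p / (p - 1)))"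

end

theory Submission
  imports Defs
begin

text \<open>
  The error of the momentum estimate splits as \<open>g\<^sub>t - \<nabla>F(x\<^sub>t) = noise\<^sub>t + drift\<^sub>t\<close>. Since the step is
  normalized, the drift is bounded surely by a multiple of \<open>\<eta> L t\<^bsup>-1/4\<^esup>\<close>. The noise is a weighted
  martingale; a von Bahr--Esseen type inequality turns its \<open>p\<close>-th moment into a scalar recursion, which
  gives \<open>E\<parallel>noise\<^sub>t\<parallel> \<le> 12 \<sigma> t\<^bsup>-(p-1)/(2p)\<^esup>\<close>. Both bounds enter the descent inequality for a normalized
  step, and summing over \<open>t\<close> produces the logarithm and the noise growth term. The sample complexity
  follows because \<open>ln T * T\<^bsup>-1/r\<^esup>\<close> is decreasing for \<open>T \<ge> exp r\<close>.
\<close>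

subsection \<open>Smoothness and normalized steps\<close>

text \<open>Only moments of order \<open>p\<close>, possibly below 2, are available, so the usual
  variance expansion is replaced by a pointwise inequality whose linear term averages to zero over
  the newest sample. As \<open>x t\<close> depends on all earlier samples, this averaging requires
  writing the state as a measurable function of the sample tuple; the joint law of that tuple and
  the next sample is a product, and Tonelli freezes the past. The exponents are equilibria. With
  \<open>\<alpha> = t powr (-1/2)\<close>, both recursions contract by \<open>1 - \<alpha>\<close>
  or better; half of this pays for moving the bound from \<open>t - 1\<close> to \<open>t\<close>,
  the other half absorbs the input. An input \<open>6 * \<alpha> powr p * K\<close> balances at
  \<open>12 * K * \<alpha> powr (p - 1)\<close>, a gradient change of order
  \<open>t powr (-3/4)\<close> at order \<open>t powr (-1/4)\<close>. The sample complexity is at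
  first circular, because the required \<open>T\<close> depends on \<open>ln T\<close>. The circle
  is broken by an a priori bound: the threshold is at most a power of \<open>1 / \<epsilon>\<close>,
  so its logarithm is at most a multiple of \<open>ln (1 / \<epsilon>)\<close>.\<close>

lemma gradient_GDERIV:
  fixes F :: "'a::euclidean_space \<Rightarrow> real"
  assumes "F differentiable (at x)"
  shows "GDERIV F x :> gradient F x"
proof -
  obtain D where D: "(F has_derivative D) (at x)"
    using assms by (auto simp: differentiable_def)
  interpret D: bounded_linear D
    using D by (rule has_derivative_bounded_linear)
  \<comment> \<open>The Riesz vector of the functional \<open>D\<close>.\<close>
  define d where "d = (\<Sum>b\<in>Basis. D b *\<^sub>R b)"
  have "D h = h \<bullet> d" for h
  proof -
    have "D h = D (\<Sum>b\<in>Basis. (h \<bullet> b) *\<^sub>R b)"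
      by (simp add: euclidean_representation)
    also have "\<dots> = h \<bullet> d"
      by (simp add: d_def D.sum D.scaleR inner_sum_right mult.commute)
    finally show ?thesis .
  qed
  then have "D = (\<lambda>h. h \<bullet> d)"
    by blast
  then have d: "GDERIV F x :> d"
    using D by (simp add: gderiv_def)
  \<comment> \<open>Uniqueness is what makes the definite description in \<open>gradient\<close>
    denote \<open>d\<close>.\<close>
  moreover have "e = d" if "GDERIV F x :> e" for e
  proof -
    have "(\<lambda>h. h \<bullet> e) = (\<lambda>h. h \<bullet> d)"
      using has_derivative_unique that d unfolding gderiv_def by blast
    then show ?thesis
      by (metis vector_eq_ldot)
  qed
  ultimately show ?thesis
    unfolding gradient_def by (rule theI)
qed

text \<open>The mean value theorem along the segment from \<open>x\<close> to \<open>y\<close> gives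
  one intermediate gradient, which differs from the one at \<open>x\<close> by at most
  \<open>L * norm (y - x)\<close>. Avoiding the integral costs a factor 2 against the sharp constant
  \<open>L / 2\<close>.\<close>

lemma L_smooth_upper_bound:
  assumes "L_smooth L F"
  shows "F y \<le> F x + (y - x) \<bullet> gradient F x + L * (norm (y - x))\<^sup>2"
proof -
  define \<phi> where "\<phi> s = F (x + s *\<^sub>R (y - x))" for s
  have "(\<phi> has_real_derivative (y - x) \<bullet> gradient F (x + s *\<^sub>R (y - x))) (at s)" for s
  proof -
    have "GDERIV F (x + s *\<^sub>R (y - x)) :> gradient F (x + s *\<^sub>R (y - x))"
      using assms by (auto simp: L_smooth_def intro: gradient_GDERIV)
    then have F: "(F has_derivative (\<lambda>h. h \<bullet> gradient F (x + s *\<^sub>R (y - x)))) (at (x + s *\<^sub>R (y - x)))"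
      by (simp add: gderiv_def)
    have "((\<lambda>s. x + s *\<^sub>R (y - x)) has_derivative (\<lambda>h. h *\<^sub>R (y - x))) (at s)"
      by (auto intro!: derivative_eq_intros)
    from diff_chain_at[OF this F]
    have "((\<lambda>s. F (x + s *\<^sub>R (y - x))) has_derivative
            (\<lambda>h. (h *\<^sub>R (y - x)) \<bullet> gradient F (x + s *\<^sub>R (y - x)))) (at s)"
      by (simp add: o_def)
    then show ?thesis
      unfolding \<phi>_def has_field_derivative_def by (simp add: mult_commute_abs)
  qed
  from MVT2[of 0 1 \<phi>, OF _ this] obtain z where z: "0 < z" "z < 1"
    "\<phi> 1 - \<phi> 0 = (y - x) \<bullet> gradient F (x + z *\<^sub>R (y - x))"
    by auto
  have L: "L-lipschitz_on UNIV (gradient F)"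
    using assms by (simp add: L_smooth_def)
  have "(y - x) \<bullet> (gradient F (x + z *\<^sub>R (y - x)) - gradient F x)
      \<le> norm (y - x) * norm (gradient F (x + z *\<^sub>R (y - x)) - gradient F x)"
    by (rule norm_cauchy_schwarz)
  also have "\<dots> \<le> norm (y - x) * (L * (z * norm (y - x)))"
    using lipschitz_onD[OF L, of "x + z *\<^sub>R (y - x)" x] z
    by (intro mult_left_mono) (auto simp: dist_norm)
  also have "\<dots> = z * (L * (norm (y - x))\<^sup>2)"
    by (simp add: power2_eq_square)
  also have "\<dots> \<le> L * (norm (y - x))\<^sup>2"
    using z lipschitz_on_nonneg[OF L] by (intro mult_left_le_one_le) auto
  finally show ?thesis
    using z(3) by (simp add: \<phi>_def inner_diff_right)
qed

text \<open>The identity \<open>sgn g \<bullet> g = norm g\<close> turns the direction into a norm.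
  The estimation error is paid twice: once for replacing \<open>g\<close> by the gradient in this
  inner product, once for comparing \<open>norm g\<close> with the gradient norm.\<close>

lemma normalized_step_descent:
  assumes "L_smooth L F" and "0 \<le> h"
  shows "h * norm (gradient F x)
    \<le> F x - F (x - h *\<^sub>R sgn g) + 2 * h * norm (g - gradient F x) + L * h\<^sup>2"
proof -
  have L: "0 \<le> L"
    using assms(1) lipschitz_on_nonneg by (auto simp: L_smooth_def)
  have sgn1: "norm (sgn g) \<le> 1"
    by (simp add: norm_sgn)
  have "sgn g \<bullet> (g - gradient F x) \<le> norm (sgn g) * norm (g - gradient F x)"
    by (rule norm_cauchy_schwarz)
  also have "\<dots> \<le> norm (g - gradient F x)"
    using sgn1 by (intro mult_left_le_one_le) auto
  moreover have "sgn g \<bullet> g = norm g"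
    by (simp add: sgn_div_norm dot_square_norm power2_eq_square field_simps)
  moreover have "norm (gradient F x) \<le> norm g + norm (g - gradient F x)"
    by norm
  ultimately have "norm (gradient F x) \<le> sgn g \<bullet> gradient F x + 2 * norm (g - gradient F x)"
    by (simp add: inner_diff_right)
  from mult_left_mono[OF this assms(2)]
  have "h * norm (gradient F x) \<le> h * (sgn g \<bullet> gradient F x) + 2 * h * norm (g - gradient F x)"
    by (simp add: algebra_simps)
  moreover have "(h * norm (sgn g))\<^sup>2 \<le> h\<^sup>2"
    using sgn1 assms(2) by (intro power_mono mult_right_le_one_le) auto
  then have "L * (h * norm (sgn g))\<^sup>2 \<le> L * h\<^sup>2"
    using L by (rule mult_left_mono)
  moreover have "F (x - h *\<^sub>R sgn g) \<le> F x - h * (sgn g \<bullet> gradient F x) + L * (h * norm (sgn g))\<^sup>2"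
    using L_smooth_upper_bound[OF assms(1), of "x - h *\<^sub>R sgn g" x] assms(2) by simp
  ultimately show ?thesis
    by linarith
qed

text \<open>This replaces the expansion of a squared norm. The coefficient of
  \<open>a \<bullet> b\<close> depends on \<open>a\<close> only, so the term vanishes when a
  centered \<open>b\<close> is averaged. For \<open>norm b \<le> norm a\<close> concavity gives the
  remainder; otherwise every term is comparable to \<open>norm b powr p\<close>.\<close>

lemma norm_add_powr_le:
  fixes a b :: "'a::real_inner"
  assumes "1 < p" and "p \<le> 2"
  shows "norm (a + b) powr p
    \<le> norm a powr p + p * norm a powr (p - 2) * (a \<bullet> b) + 6 * norm b powr p"
proof (cases "a = 0")
  case False
  then have a: "0 < norm a"
    by simp
  show ?thesis
  proof (cases "norm b \<le> norm a")
    case True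
    \<comment> \<open>the tangent bound for the concave function \<open>u powr (p / 2)\<close> at \<open>(norm a)\<^sup>2\<close>\<close>
    have Y: "norm (a + b) powr p * norm a powr (2 - p)
      \<le> p / 2 * (norm (a + b))\<^sup>2 + (1 - p / 2) * (norm a)\<^sup>2"
    proof (cases "a + b = 0")
      case False
      have "norm (a + b) powr p * norm a powr (2 - p)
        = ((norm (a + b))\<^sup>2) powr (p / 2) * ((norm a)\<^sup>2) powr (1 - p / 2)"
        using False a by (simp add: powr_powr flip: powr_numeral)
      also have "\<dots> \<le> p / 2 * (norm (a + b))\<^sup>2 + (1 - p / 2) * (norm a)\<^sup>2"
        using assms False a by (intro Youngs_inequality_0) auto
      finally show ?thesis .
    qed (use assms in simp)
    have "norm (a + b) powr p
      = (norm (a + b) powr p * norm a powr (2 - p)) * norm a powr (p - 2)"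
      using a by (simp flip: powr_add)
    also have "\<dots> \<le> (p / 2 * (norm (a + b))\<^sup>2 + (1 - p / 2) * (norm a)\<^sup>2) * norm a powr (p - 2)"
      using Y by (rule mult_right_mono) simp
    also have "(norm (a + b))\<^sup>2 = (norm a)\<^sup>2 + 2 * (a \<bullet> b) + (norm b)\<^sup>2"
      by (simp add: power2_norm_eq_inner inner_add inner_commute)
    also have "(p / 2 * ((norm a)\<^sup>2 + 2 * (a \<bullet> b) + (norm b)\<^sup>2) + (1 - p / 2) * (norm a)\<^sup>2) * norm a powr (p - 2)
      = (norm a)\<^sup>2 * norm a powr (p - 2) + p * norm a powr (p - 2) * (a \<bullet> b)
        + p / 2 * ((norm b)\<^sup>2 * norm a powr (p - 2))"
      by (simp add: field_simps)
    also have "(norm a)\<^sup>2 * norm a powr (p - 2) = norm a powr p"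
      using a by (simp flip: powr_numeral powr_add)
    also have "(norm b)\<^sup>2 * norm a powr (p - 2) \<le> norm b powr p"
    proof (cases "b = 0")
      case False
      have "(norm b)\<^sup>2 * norm a powr (p - 2) \<le> (norm b)\<^sup>2 * norm b powr (p - 2)"
        using False True assms by (intro mult_left_mono powr_mono2') auto
      also have "\<dots> = norm b powr p"
        using False by (simp flip: powr_numeral powr_add)
      finally show ?thesis .
    qed simp
    then have "p / 2 * ((norm b)\<^sup>2 * norm a powr (p - 2)) \<le> 6 * norm b powr p"
      using assms by (intro mult_mono) auto
    finally show ?thesis
      by simp
  next
    case False
    \<comment> \<open>Origin of the 6: \<open>2 powr p \<le> 4\<close> for the left-hand side, and
      \<open>p \<le> 2\<close> for the linear term, which may be negative.\<close>
    have "norm (a + b) \<le> 2 * norm b"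
      using False norm_triangle_ineq[of a b] by linarith
    then have "norm (a + b) powr p \<le> (2 * norm b) powr p"
      using assms by (intro powr_mono2) auto
    also have "\<dots> = 2 powr p * norm b powr p"
      by (simp add: powr_mult)
    also have "\<dots> \<le> 4 * norm b powr p"
      using powr_mono[of p 2 2] assms by (intro mult_right_mono) auto
    finally have 1: "norm (a + b) powr p \<le> 4 * norm b powr p" .
    have "- (a \<bullet> b) \<le> norm a * norm b"
      using Cauchy_Schwarz_ineq2[of a b] by linarith
    then have "p * norm a powr (p - 2) * - (a \<bullet> b) \<le> p * norm a powr (p - 2) * (norm a * norm b)"
      using assms by (intro mult_left_mono) auto
    also have "\<dots> = p * (norm a powr (p - 1) * norm b)"
      using a powr_add[of "norm a" "p - 2" 1] by simp
    also have "\<dots> \<le> 2 * (norm b powr (p - 1) * norm b)"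
      using assms False by (intro mult_mono powr_mono2) auto
    also have "\<dots> = 2 * norm b powr p"
      using powr_add[of "norm b" "p - 1" 1] by simp
    finally have "- (p * norm a powr (p - 2) * (a \<bullet> b)) \<le> 2 * norm b powr p"
      by simp
    then show ?thesis
      using 1 powr_ge_zero[of "norm a" p] by linarith
  qed
qed simp

subsection \<open>Scalar recursions and sums\<close>

text \<open>Moving a power bound from \<open>t - 1\<close> to \<open>t\<close> costs a power of
  \<open>t / (t - 1)\<close> with exponent at most 1/2; this cost uses up at most half of the
  contraction. Squaring and setting \<open>u = sqrt t\<close> leaves a rational inequality in
  \<open>u\<close>.\<close>

lemma momentum_contraction:
  fixes t :: real
  assumes "1 < t"
  shows "(1 - t powr (-1/2)) * (t / (t - 1)) powr (1/2) \<le> 1 - t powr (-1/2) / 2"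
proof (rule power2_le_imp_le)
  define u where "u = sqrt t"
  have u: "1 < u" "t = u\<^sup>2"
    using assms by (auto simp: u_def)
  have a: "t powr (-1/2) = 1 / u"
    using assms by (simp add: u_def powr_minus powr_half_sqrt inverse_eq_divide)
  have "((t / (t - 1)) powr (1/2))\<^sup>2 = t / (t - 1)"
    using assms by (simp add: powr_half_sqrt)
  then have "((1 - t powr (-1/2)) * (t / (t - 1)) powr (1/2))\<^sup>2 = (1 - 1 / u)\<^sup>2 * (t / (t - 1))"
    by (simp only: power_mult_distrib a)
  also have "\<dots> = ((1 - 1 / u) * u)\<^sup>2 / ((u - 1) * (u + 1))"
    unfolding u(2) power_mult_distrib by (simp add: algebra_simps power2_eq_square[of u])
  also have "(1 - 1 / u) * u = u - 1"
    using u by (simp add: left_diff_distrib)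
  also have "(u - 1)\<^sup>2 / ((u - 1) * (u + 1)) = (u - 1) / (u + 1)"
    using u by (simp add: power2_eq_square)
  also have "\<dots> \<le> (1 - 1 / u / 2)\<^sup>2"
  proof -
    have "(2 * u - 1)\<^sup>2 * (u + 1) - (u - 1) * (4 * u\<^sup>2) = u\<^sup>2 + (u - 1) * (3 * u) + 1"
      by (simp add: algebra_simps power2_eq_square)
    also have "\<dots> \<ge> 0"
      using u by simp
    finally have "(u - 1) / (u + 1) \<le> (2 * u - 1)\<^sup>2 / (4 * u\<^sup>2)"
      using u by (simp add: divide_simps)
    also have "\<dots> = (1 - 1 / u / 2)\<^sup>2"
      using u by (simp add: power2_eq_square field_simps)
    finally show ?thesis .
  qed
  finally show "((1 - t powr (-1/2)) * (t / (t - 1)) powr (1/2))\<^sup>2 \<le> (1 - t powr (-1/2) / 2)\<^sup>2"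
    by (simp only: a)
  show "0 \<le> 1 - t powr (-1/2) / 2"
    unfolding a using u by (simp add: field_simps)
qed

lemma powr_minus_shift:
  fixes t a :: real
  assumes "1 < t"
  shows "(t - 1) powr (- a) = t powr (- a) * (t / (t - 1)) powr a"
proof -
  have "(t - 1) powr (- a) = t powr (- a) * (t powr a / (t - 1) powr a)"
    using assms by (simp add: powr_minus_divide)
  then show ?thesis
    using assms by (simp only: powr_divide)
qed

text \<open>The induction closes because the remaining half of the contraction removes
  \<open>12 * K * s * \<alpha> / 2\<close>, exactly the input
  \<open>6 * \<alpha> powr p * K\<close>, as \<open>\<alpha> powr p = s * \<alpha>\<close>. This
  fixes the constant 12.\<close>

lemma momentum_moment_recursion:
  fixes m :: "nat \<Rightarrow> real"
  assumes p: "1 < p" "p \<le> 2" and K: "0 \<le> K"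
    and rec: "\<And>t. 1 \<le> t \<Longrightarrow>
      m t \<le> (1 - real t powr (-1/2)) powr p * m (t - 1) + 6 * (real t powr (-1/2)) powr p * K"
    and t: "1 \<le> t"
  shows "m t \<le> 12 * K * real t powr (- (p - 1) / 2)"
  using t
proof (induction t rule: nat_induct_at_least)
  case base
  \<comment> \<open>At \<open>t = 1\<close> the contraction factor is 0, so the value
    \<open>m 0\<close> disappears.\<close>
  show ?case
    using rec[of 1] K p by simp
next
  case (Suc n)
  define t where "t = real (Suc n)"
  have t: "1 < t" "real n = t - 1" "2 \<le> t"
    using Suc.hyps by (auto simp: t_def)
  define \<alpha> where "\<alpha> = t powr (-1/2)"
  define s where "s = t powr (- (p - 1) / 2)"
  define \<rho> where "\<rho> = (t / (t - 1)) powr (1/2)"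
  have \<alpha>: "0 \<le> \<alpha>" "\<alpha> \<le> 1"
    using t powr_mono[of "-1/2" 0 t] by (auto simp: \<alpha>_def)
  have "m (Suc n) \<le> (1 - \<alpha>) powr p * m n + 6 * \<alpha> powr p * K"
    using rec[of "Suc n"] by (simp add: \<alpha>_def t_def)
  also have "(1 - \<alpha>) powr p * m n \<le> (1 - \<alpha>) powr p * (12 * K * (t - 1) powr (- (p - 1) / 2))"
    using Suc.IH t by (intro mult_left_mono) auto
  also have "\<dots> \<le> (1 - \<alpha>) * (12 * K * (s * \<rho>))"
  proof (intro mult_mono)
    show "(1 - \<alpha>) powr p \<le> 1 - \<alpha>"
      using powr_mono'[of 1 p "1 - \<alpha>"] \<alpha> p by simp
    have "(t - 1) powr (- ((p - 1) / 2)) = t powr (- ((p - 1) / 2)) * (t / (t - 1)) powr ((p - 1) / 2)"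
      using t by (intro powr_minus_shift)
    also have "\<dots> \<le> t powr (- ((p - 1) / 2)) * \<rho>"
      unfolding \<rho>_def using t p by (intro mult_left_mono powr_mono) auto
    finally show "(t - 1) powr (- (p - 1) / 2) \<le> s * \<rho>"
      by (simp add: s_def minus_divide_left)
  qed (use K \<alpha> in auto)
  also have "\<dots> = 12 * K * s * ((1 - \<alpha>) * \<rho>)"
    by simp
  also have "\<dots> \<le> 12 * K * s * (1 - \<alpha> / 2)"
    using momentum_contraction[OF t(1)] K
    by (intro mult_left_mono) (auto simp: \<alpha>_def \<rho>_def s_def)
  also have "\<alpha> powr p = s * \<alpha>"
    using t by (simp add: \<alpha>_def s_def powr_powr field_simps flip: powr_add)
  finally have "m (Suc n) \<le> 12 * K * s"
    by (simp add: algebra_simps)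
  then show ?case
    by (simp add: s_def t_def)
qed

text \<open>The constant 4 is twice the 2 that bounds the input relative to
  \<open>K * s * \<alpha>\<close>: the product
  \<open>(4 + 2 * \<alpha>) * (1 - \<alpha> / 2)\<close> is \<open>4 - \<alpha>\<^sup>2\<close>, so
  the induction closes. At \<open>t = 1\<close> the factor 0 again removes all data of index
  0.\<close>

lemma momentum_drift_recursion:
  fixes d :: "nat \<Rightarrow> real"
  assumes K: "0 \<le> K"
    and rec: "\<And>t. 1 \<le> t \<Longrightarrow>
      d t \<le> (1 - real t powr (-1/2)) * (d (t - 1) + K * real (t - 1) powr (-3/4))"
    and t: "1 \<le> t"
  shows "d t \<le> 4 * K * real t powr (-1/4)"
  using t
proof (induction t rule: nat_induct_at_least)
  case base
  show ?case
    using rec[of 1] K by simp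
next
  case (Suc n)
  define t where "t = real (Suc n)"
  have t: "1 < t" "real n = t - 1" "2 \<le> t"
    using Suc.hyps by (auto simp: t_def)
  define \<alpha> where "\<alpha> = t powr (-1/2)"
  define s where "s = t powr (-1/4)"
  define \<rho> where "\<rho> = t / (t - 1)"
  have \<alpha>: "0 \<le> \<alpha>" "\<alpha> \<le> 1"
    using t powr_mono[of "-1/2" 0 t] by (auto simp: \<alpha>_def)
  have \<rho>: "1 \<le> \<rho>" "\<rho> \<le> 2"
    using t by (auto simp: \<rho>_def field_simps)
  have contr: "(1 - \<alpha>) * \<rho> powr (1/2) \<le> 1 - \<alpha> / 2"
    using momentum_contraction[OF t(1)] by (simp add: \<alpha>_def \<rho>_def)
  have "(t - 1) powr (-(1/4)) = s * \<rho> powr (1/4)"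
    unfolding s_def \<rho>_def using powr_minus_shift[OF t(1), of "1/4"] by simp
  also have "\<dots> \<le> s * \<rho> powr (1/2)"
    using \<rho> by (intro mult_left_mono powr_mono) (auto simp: s_def)
  finally have s: "(t - 1) powr (-(1/4)) \<le> s * \<rho> powr (1/2)" .
  have "(t - 1) powr (-(3/4)) = t powr (-(3/4)) * \<rho> powr (3/4)"
    unfolding \<rho>_def using t by (intro powr_minus_shift)
  also have "t powr (-(3/4)) = s * \<alpha>"
    using t by (simp add: s_def \<alpha>_def flip: powr_add)
  also have "\<rho> powr (3/4) = \<rho> powr (1/4) * \<rho> powr (1/2)"
    by (simp flip: powr_add)
  \<comment> \<open>Of the shift factor \<open>\<rho> powr (3/4)\<close>, only
    \<open>\<rho> powr (1/2)\<close> can be given to the contraction; the rest is bounded by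
    \<open>\<rho> \<le> 2\<close>.\<close>
  also have "s * \<alpha> * (\<rho> powr (1/4) * \<rho> powr (1/2)) \<le> s * \<alpha> * (2 * \<rho> powr (1/2))"
    using \<rho> \<alpha> powr_mono[of "1/4" 1 \<rho>]
    by (intro mult_left_mono mult_right_mono) (auto simp: s_def)
  finally have s3: "(t - 1) powr (-(3/4)) \<le> s * \<alpha> * (2 * \<rho> powr (1/2))" .
  have "d (Suc n) \<le> (1 - \<alpha>) * (d n + K * (t - 1) powr (-(3/4)))"
    using rec[of "Suc n"] by (simp add: \<alpha>_def t_def)
  also have "\<dots> \<le> (1 - \<alpha>) * (4 * K * (s * \<rho> powr (1/2)) + K * (s * \<alpha> * (2 * \<rho> powr (1/2))))"
  proof (intro mult_left_mono add_mono)
    have "d n \<le> 4 * K * (t - 1) powr (-(1/4))"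
      using Suc.IH t by simp
    also have "\<dots> \<le> 4 * K * (s * \<rho> powr (1/2))"
      using s K by (intro mult_left_mono) auto
    finally show "d n \<le> 4 * K * (s * \<rho> powr (1/2))" .
  qed (use s3 K \<alpha> in auto)
  also have "\<dots> = K * s * (4 + 2 * \<alpha>) * ((1 - \<alpha>) * \<rho> powr (1/2))"
    by (simp add: algebra_simps)
  also have "\<dots> \<le> K * s * (4 + 2 * \<alpha>) * (1 - \<alpha> / 2)"
    using contr K \<alpha> by (intro mult_left_mono) (auto simp: s_def)
  also have "\<dots> = K * s * (4 - \<alpha>\<^sup>2)"
    by (simp add: algebra_simps power2_eq_square)
  also have "\<dots> \<le> K * s * 4"
    using K by (intro mult_left_mono) (auto simp: s_def)
  finally show ?case
    by (simp add: s_def t_def)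
qed

text \<open>\<open>noise_growth p\<close> is the antiderivative of a power that vanishes at 1, and
  \<open>p = 2\<close> is the logarithmic case. Through this fact later sums need no case
  distinction.\<close>

lemma noise_growth_deriv:
  assumes "0 < p" and "0 < x"
  shows "(noise_growth p has_real_derivative x powr ((2 - p) / (4 * p) - 1)) (at x)"
proof (cases "p = 2")
  case True
  have "((\<lambda>x. ln x) has_real_derivative x powr - 1) (at x)"
    using assms by (auto intro!: derivative_eq_intros simp: powr_minus_divide)
  then show ?thesis
    using True by (simp add: noise_growth_def[abs_def])
next
  case False
  define q where "q = (2 - p) / (4 * p)"
  have q: "q \<noteq> 0" "4 * p / (2 - p) = 1 / q"
    using False assms by (auto simp: q_def)
  have "((\<lambda>x. 1 / q * (x powr q - 1)) has_real_derivative x powr (q - 1)) (at x)"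
    using assms q by (auto intro!: derivative_eq_intros)
  then show ?thesis
    using False q by (simp add: noise_growth_def[abs_def] flip: q_def)
qed

lemma noise_growth_one [simp]: "noise_growth p 1 = 0"
  by (simp add: noise_growth_def)

text \<open>Integral comparison, by the mean value theorem on each unit interval; the 1 is the first
  summand. The condition on \<open>p\<close> makes the exponent negative, so the summands decrease.
  At \<open>p = 2\<close> this is the bound for the harmonic sum.\<close>

lemma sum_powr_le_noise_growth:
  assumes p: "2 / 5 < p" and T: "1 \<le> T"
  shows "(\<Sum>t=1..T. real t powr ((2 - p) / (4 * p) - 1)) \<le> 1 + noise_growth p (real T)"
  using T
proof (induction T rule: nat_induct_at_least)
  case base
  then show ?case by simp
next
  case (Suc n)
  define q where "q = (2 - p) / (4 * p)"
  have q: "q < 1"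
    using p by (simp add: q_def field_simps)
  obtain z where z: "real n < z" "z < real (Suc n)"
    "noise_growth p (real (Suc n)) - noise_growth p (real n) = (real (Suc n) - real n) * z powr (q - 1)"
    using MVT2[of "real n" "real (Suc n)" "noise_growth p" "\<lambda>z. z powr (q - 1)"]
      noise_growth_deriv[of p] Suc.hyps p unfolding q_def by force
  have "real (Suc n) powr (q - 1) \<le> z powr (q - 1)"
    using z q Suc.hyps by (intro powr_mono2') auto
  then show ?case
    using Suc.IH z(3) unfolding q_def by simp
qed

text \<open>From \<open>exp u \<ge> 1 + u\<close> at \<open>u = q * ln x\<close>. It makes
  \<open>noise_growth\<close> at least 1 from \<open>T = 3\<close> on, so that additive constants
  can be absorbed.\<close>

lemma noise_growth_lower:
  assumes "1 < p" "p \<le> 2" and "0 < x"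
  shows "ln x \<le> noise_growth p x"
proof (cases "p = 2")
  case False
  define q where "q = (2 - p) / (4 * p)"
  have q: "0 < q" "4 * p / (2 - p) = 1 / q"
    using False assms by (auto simp: q_def)
  have "q * ln x \<le> x powr q - 1"
    using exp_ge_add_one_self[of "q * ln x"] assms by (simp add: powr_def algebra_simps)
  then have "ln x \<le> 1 / q * (x powr q - 1)"
    using q by (simp add: field_simps)
  then show ?thesis
    using False q by (simp add: noise_growth_def flip: q_def)
qed (simp add: noise_growth_def)

text \<open>The same exponential inequality at \<open>- q * ln x\<close>, multiplied by
  \<open>x powr q\<close>. The prefactor \<open>1 / q\<close>, which blows up as \<open>p\<close>
  tends to 2, is traded for a logarithm.\<close>

lemma noise_growth_upper:
  assumes "1 < p" "p \<le> 2" and "0 < x"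
  shows "noise_growth p x \<le> ln x * x powr ((2 - p) / (4 * p))"
proof (cases "p = 2")
  case False
  define q where "q = (2 - p) / (4 * p)"
  have q: "0 < q" "4 * p / (2 - p) = 1 / q"
    using False assms by (auto simp: q_def)
  have "1 - q * ln x \<le> x powr (- q)"
    using exp_ge_add_one_self[of "- q * ln x"] assms by (simp add: powr_def)
  from mult_right_mono[OF this, of "x powr q"]
  have "x powr q - 1 \<le> q * (ln x * x powr q)"
    using assms by (simp add: algebra_simps flip: powr_add)
  then have "1 / q * (x powr q - 1) \<le> ln x * x powr q"
    using q by (simp add: field_simps)
  then show ?thesis
    using False q by (simp add: noise_growth_def flip: q_def)
qed (use assms in \<open>simp add: noise_growth_def\<close>)

section \<open>From the explicit bound to the soft rate\<close>

lemma ln_nat_ge_one: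
  assumes "3 \<le> (T :: nat)"
  shows "1 \<le> ln (real T)"
  using assms exp_le by (subst ln_ge_iff) auto

text \<open>The hidden constant is the sum of the three coefficients. One logarithm suffices: it is
  at least 1 in the \<Delta> term, present in the \<open>L\<close> term, and supplied by
  \<open>noise_growth_upper\<close> in the \<sigma> term.\<close>

lemma nsgd_bound_le_soft_rate:
  assumes p: "1 < p" "p \<le> 2" and \<eta>: "0 < \<eta>"
    and nonneg: "0 \<le> \<Delta>" "0 \<le> L" "0 \<le> \<sigma>" and T: "3 \<le> T"
  shows "nsgd_bound \<eta> p \<Delta> L \<sigma> T \<le> soft_rate (1 / \<eta> + 120 * \<eta> + 120) 1 p \<Delta> L \<sigma> T"
proof -
  define C where "C = 1 / \<eta> + 120 * \<eta> + 120"
  define l where "l = ln (real T)"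
  define a where "a = real T powr (-1/4)"
  define b where "b = real T powr ((2 - p) / (4 * p))"
  have l: "1 \<le> l"
    using T ln_nat_ge_one by (simp add: l_def)
  have C: "1 / \<eta> \<le> C" "120 * \<eta> \<le> C" "120 \<le> C"
    using \<eta> by (auto simp: C_def)
  have pos: "0 \<le> a" "0 \<le> b"
    by (auto simp: a_def b_def)
  have ab: "a * b = real T powr (- (p - 1) / (2 * p))"
  proof -
    have "-1/4 + (2 - p) / (4 * p) = - (p - 1) / (2 * p)"
      using p by (simp add: field_simps)
    then show ?thesis
      by (simp add: a_def b_def flip: powr_add)
  qed
  have "\<Delta> / \<eta> \<le> C * l * \<Delta>"
  proof -
    have "\<Delta> / \<eta> \<le> C * \<Delta>"
      using mult_right_mono[OF C(1) nonneg(1)] by simp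
    also have "\<dots> \<le> (C * \<Delta>) * l"
      using l nonneg C by (intro mult_left_mono[of 1 l, simplified]) auto
    finally show ?thesis
      by (simp add: mult_ac)
  qed
  moreover have "120 * \<eta> * L * l \<le> C * l * L"
    using mult_right_mono[OF C(2), of "L * l"] nonneg l by (simp add: mult_ac)
  moreover have "120 * \<sigma> * noise_growth p (real T) \<le> C * l * \<sigma> * b"
  proof -
    have "120 * \<sigma> * noise_growth p (real T) \<le> C * \<sigma> * (l * b)"
      unfolding l_def b_def
      using noise_growth_upper[OF p, of "real T"] noise_growth_lower[OF p, of "real T"] T nonneg C l
      by (intro mult_mono) (auto simp: l_def)
    then show ?thesis
      by (simp add: mult_ac)
  qed
  ultimately have "(\<Delta> / \<eta> + 120 * \<eta> * L * l + 120 * \<sigma> * noise_growth p (real T)) * a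
    \<le> (C * l * \<Delta> + C * l * L + C * l * \<sigma> * b) * a"
    by (intro mult_right_mono pos) auto
  also have "\<dots> = C * l * ((\<Delta> + L) * a + \<sigma> * (a * b))"
    by (simp add: algebra_simps)
  finally show ?thesis
    unfolding nsgd_bound_def soft_rate_def ab
    by (simp add: powr_minus field_simps C_def l_def a_def)
qed

lemma ln_mult_powr_antimono:
  fixes x y r :: real
  assumes r: "0 < r" and x: "exp r \<le> x" and y: "x \<le> y"
  shows "ln y * y powr (- (1 / r)) \<le> ln x * x powr (- (1 / r))"
proof (rule DERIV_nonpos_imp_nonincreasing[OF y])
  fix z assume z: "x \<le> z" "z \<le> y"
  have "0 < z"
    using x z exp_gt_zero[of r] by linarith
  moreover have "r \<le> ln z"
    using x z \<open>0 < z\<close> by (simp add: ln_ge_iff)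
  ultimately have "((\<lambda>z. ln z * z powr (- (1 / r))) has_real_derivative
      (1 - ln z / r) * z powr (- (1 / r) - 1)) (at z)" "1 - ln z / r \<le> 0"
    using r by (auto intro!: derivative_eq_intros simp: powr_diff left_diff_distrib diff_divide_distrib)
  then show "\<exists>D. ((\<lambda>z. ln z * z powr (- (1 / r))) has_real_derivative D) (at z) \<and> D \<le> 0"
    by (intro exI conjI) (auto intro: mult_nonpos_nonneg)
qed

subsection \<open>Moments of centered increments\<close>

text \<open>The pointwise majorant \<open>h\<close> is integrable and its linear term has mean zero.
  The left side is a nonnegative integral so that Tonelli can use the result directly.\<close>

lemma (in prob_space) nn_integral_norm_add_centered_powr_le:
  fixes n :: "'a \<Rightarrow> 'b::euclidean_space"
  assumes p: "1 < p" "p \<le> 2" and a: "0 \<le> a"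
    and n: "integrable M n" "expectation n = 0"
    and np: "integrable M (\<lambda>s. norm (n s) powr p)"
      "expectation (\<lambda>s. norm (n s) powr p) \<le> K"
  shows "(\<integral>\<^sup>+ s. norm (c + a *\<^sub>R n s) powr p \<partial>M) \<le> ennreal (norm c powr p + 6 * a powr p * K)"
proof -
  define h where "h s = norm c powr p + p * norm c powr (p - 2) * a * (c \<bullet> n s)
      + 6 * a powr p * norm (n s) powr p" for s
  have le: "norm (c + a *\<^sub>R n s) powr p \<le> h s" for s
    using norm_add_powr_le[OF p, of c "a *\<^sub>R n s"] a
    by (simp add: h_def powr_mult mult_ac)
  have h: "integrable M h"
    unfolding h_def using n np by (auto intro!: Bochner_Integration.integrable_add)
  have "(\<integral>\<^sup>+ s. norm (c + a *\<^sub>R n s) powr p \<partial>M) \<le> (\<integral>\<^sup>+ s. ennreal (h s) \<partial>M)"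
    by (intro nn_integral_mono ennreal_leI le)
  also have "\<dots> = ennreal (expectation h)"
    using h order_trans[OF powr_ge_zero le] by (intro nn_integral_eq_integral AE_I2)
  also have "expectation h = norm c powr p + 6 * a powr p * expectation (\<lambda>s. norm (n s) powr p)"
    unfolding h_def using n np by (simp add: prob_space)
  also have "\<dots> \<le> norm c powr p + 6 * a powr p * K"
    using np by (intro add_left_mono mult_left_mono) auto
  finally show ?thesis
    by (simp add: ennreal_leI)
qed

text \<open>A conditioning argument without conditional expectations: \<open>S\<close> is the past,
  \<open>Y\<close> the fresh sample. Since the joint law is a product, Tonelli integrates over
  \<open>Y\<close> with the past frozen, where the increment is centered.\<close>

lemma (in prob_space) nn_integral_norm_add_indep_powr_le:
  fixes c :: "'h \<Rightarrow> 'b::euclidean_space"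
  assumes p: "1 < p" "p \<le> 2" and a: "0 \<le> a" and K: "0 \<le> K"
    and S [measurable]: "S \<in> M \<rightarrow>\<^sub>M N" and Y [measurable]: "Y \<in> M \<rightarrow>\<^sub>M D" and D: "prob_space D"
    and joint: "distr M (N \<Otimes>\<^sub>M D) (\<lambda>\<omega>. (S \<omega>, Y \<omega>)) = distr M N S \<Otimes>\<^sub>M D"
    and c [measurable]: "c \<in> borel_measurable N"
    and n [measurable]: "case_prod n \<in> borel_measurable (N \<Otimes>\<^sub>M D)"
    and centered: "\<And>h. h \<in> space N \<Longrightarrow> integrable D (n h) \<and> (\<integral>s. n h s \<partial>D) = 0 \<and>
      integrable D (\<lambda>s. norm (n h s) powr p) \<and> (\<integral>s. norm (n h s) powr p \<partial>D) \<le> K"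
  shows "(\<integral>\<^sup>+ \<omega>. norm (c (S \<omega>) + a *\<^sub>R n (S \<omega>) (Y \<omega>)) powr p \<partial>M)
    \<le> (\<integral>\<^sup>+ \<omega>. norm (c (S \<omega>)) powr p \<partial>M) + ennreal (6 * a powr p * K)"
proof -
  interpret D: prob_space D
    by (rule D)
  have "(\<integral>\<^sup>+ \<omega>. norm (c (S \<omega>) + a *\<^sub>R n (S \<omega>) (Y \<omega>)) powr p \<partial>M)
    = (\<integral>\<^sup>+ z. norm (c (fst z) + a *\<^sub>R n (fst z) (snd z)) powr p \<partial>distr M (N \<Otimes>\<^sub>M D) (\<lambda>\<omega>. (S \<omega>, Y \<omega>)))"
    by (subst nn_integral_distr) (auto simp: split_beta')
  also have "\<dots> = (\<integral>\<^sup>+ h. \<integral>\<^sup>+ s. norm (c h + a *\<^sub>R n h s) powr p \<partial>D \<partial>distr M N S)"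
    unfolding joint by (subst D.nn_integral_fst[symmetric]) (auto simp: split_beta')
  also have "\<dots> \<le> (\<integral>\<^sup>+ h. ennreal (norm (c h) powr p) + ennreal (6 * a powr p * K) \<partial>distr M N S)"
    using centered K
    by (intro nn_integral_mono)
      (auto intro!: D.nn_integral_norm_add_centered_powr_le p a simp flip: ennreal_plus)
  also have "\<dots> = (\<integral>\<^sup>+ \<omega>. ennreal (norm (c (S \<omega>)) powr p) + ennreal (6 * a powr p * K) \<partial>M)"
    by (subst nn_integral_distr) auto
  also have "\<dots> = (\<integral>\<^sup>+ \<omega>. norm (c (S \<omega>)) powr p \<partial>M) + ennreal (6 * a powr p * K)"
    by (subst nn_integral_add) (auto simp: emeasure_space_1)
  finally show ?thesis .
qed

text \<open>Jensen by way of a tangent line, which yields integrability and the bound from one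
  estimate of a nonnegative integral. The case \<open>c = 0\<close> is separate because the tangent
  of \<open>u powr (1 / p)\<close> at 0 is vertical.\<close>

lemma (in prob_space) expectation_le_of_powr_moment:
  fixes X :: "'a \<Rightarrow> real"
  assumes p: "1 < p" and c: "0 \<le> c"
    and X [measurable]: "X \<in> borel_measurable M" "\<And>\<omega>. 0 \<le> X \<omega>"
    and moment: "(\<integral>\<^sup>+ \<omega>. X \<omega> powr p \<partial>M) \<le> ennreal (c powr p)"
  shows "integrable M X" and "expectation X \<le> c"
proof -
  have "(\<integral>\<^sup>+ \<omega>. X \<omega> \<partial>M) \<le> ennreal c"
  proof (cases "c = 0")
    case True
    then have "(\<integral>\<^sup>+ \<omega>. X \<omega> powr p \<partial>M) = 0"
      using moment by simp
    then have "AE \<omega> in M. ennreal (X \<omega> powr p) = 0"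
      by (subst (asm) nn_integral_0_iff_AE) auto
    then have "AE \<omega> in M. ennreal (X \<omega>) = 0"
      by eventually_elim (auto simp: ennreal_eq_0_iff X)
    then show ?thesis
      by (subst nn_integral_cong_AE[of _ "\<lambda>_. 0"]) auto
  next
    case False
    then have c: "0 < c"
      using c by simp
    \<comment> \<open>The slope of \<open>u powr (1 / p)\<close> at \<open>u = c powr p\<close>; the
      next inequality is this tangent bound at \<open>u = X \<omega> powr p\<close>.\<close>
    define w where "w = 1 / (p * c powr (p - 1))"
    have "X \<omega> \<le> w * X \<omega> powr p + (1 - 1 / p) * c" for \<omega>
    proof (cases "X \<omega> = 0")
      case False
      then have x: "0 < X \<omega>"
        using X(2)[of \<omega>] by simp
      have "X \<omega> = X \<omega> powr (p * (1 / p)) * c powr ((1 - p) * (1 / p) + (1 - 1 / p))"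
        using x c p by (simp add: field_simps)
      also have "\<dots> = (X \<omega> powr p * c powr (1 - p)) powr (1 / p) * c powr (1 - 1 / p)"
        using x c by (simp only: powr_mult powr_powr powr_add mult.assoc)
      also have "\<dots> \<le> 1 / p * (X \<omega> powr p * c powr (1 - p)) + (1 - 1 / p) * c"
        using x c p by (intro Youngs_inequality_0) auto
      also have "1 / p * (X \<omega> powr p * c powr (1 - p)) = w * X \<omega> powr p"
        using powr_minus_divide[of c "p - 1"] by (simp add: w_def)
      finally show ?thesis .
    qed (use p c in simp)
    then have "(\<integral>\<^sup>+ \<omega>. X \<omega> \<partial>M) \<le> (\<integral>\<^sup>+ \<omega>. ennreal w * ennreal (X \<omega> powr p) + ennreal ((1 - 1 / p) * c) \<partial>M)"
      using p c by (intro nn_integral_mono)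
        (auto simp: w_def ennreal_leI simp flip: ennreal_plus ennreal_mult)
    also have "\<dots> = ennreal w * (\<integral>\<^sup>+ \<omega>. X \<omega> powr p \<partial>M) + ennreal ((1 - 1 / p) * c)"
      by (subst nn_integral_add) (auto simp: nn_integral_cmult emeasure_space_1)
    also have "\<dots> \<le> ennreal w * ennreal (c powr p) + ennreal ((1 - 1 / p) * c)"
      by (intro add_right_mono mult_left_mono moment) auto
    also have "\<dots> = ennreal (w * c powr p + (1 - 1 / p) * c)"
      using p c by (simp add: w_def flip: ennreal_plus ennreal_mult)
    also have "w * c powr p + (1 - 1 / p) * c = c"
      using p c by (simp add: w_def powr_diff field_simps)
    finally show ?thesis .
  qed
  then show "integrable M X" "expectation X \<le> c"
    using X c by (auto intro!: integrableI_bounded integral_real_bounded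
        simp: le_less_trans[OF _ ennreal_less_top])
qed

subsection \<open>Normalized SGD with momentum\<close>

locale nsgd =
  fixes \<eta> p \<Delta> L \<sigma> :: real
    and M :: "'w measure" and D :: "'xi measure" and \<xi> df
    and F :: "'a::euclidean_space \<Rightarrow> real" and Fstar x1 x g
  assumes \<eta>: "0 < \<eta>" and p: "1 < p" "p \<le> 2"
    and run: "nsgd_run \<eta> p \<Delta> L \<sigma> M D \<xi> df F Fstar x1 x g"
begin

section \<open>Unpacking the run, its parameters and its decomposition\<close>

lemma smooth: "L_smooth L F"
  and lipschitz: "L-lipschitz_on UNIV (gradient F)"
  using run by (auto simp: nsgd_run_def L_smooth_def)

lemma L_nonneg: "0 \<le> L"
  using lipschitz by (rule lipschitz_on_nonneg)

lemma \<sigma>_nonneg: "0 \<le> \<sigma>"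
  using run by (auto simp: nsgd_run_def p_BCM_def)

lemma indep_samples: "prob_space.indep_vars M (\<lambda>_. D) \<xi> {1..}"
  and distr_sample: "1 \<le> t \<Longrightarrow> distr M D (\<xi> t) = D"
  using run by (auto simp: nsgd_run_def iid_samples_def)

sublocale prob_space M
  using run by (auto simp: nsgd_run_def iid_samples_def)

lemma measurable_gradient [measurable]: "gradient F \<in> borel_measurable borel"
  using lipschitz_on_continuous_on[OF lipschitz] by (rule borel_measurable_continuous_onI)

lemma measurable_stoch_gradient [measurable]: "case_prod df \<in> borel_measurable (borel \<Otimes>\<^sub>M D)"
  using run by (auto simp: nsgd_run_def p_BCM_def)

lemma stoch_gradient:
  shows "integrable D (df y)" and "(\<integral>s. df y s \<partial>D) = gradient F y"
    and "integrable D (\<lambda>s. norm (df y s - gradient F y) powr p)"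
    and "(\<integral>s. norm (df y s - gradient F y) powr p \<partial>D) \<le> \<sigma> powr p"
  using run by (auto simp: nsgd_run_def p_BCM_def)

lemma prob_space_D: "prob_space D"
  using run by (auto simp: nsgd_run_def p_BCM_def)

text \<open>The weight \<open>1 - \<beta> t\<close> of the newest stochastic gradient; it equals 1
  at \<open>t = 1\<close>.\<close>

definition \<alpha> :: "nat \<Rightarrow> real" where "\<alpha> t = real t powr (-1/2)"

definition h :: "nat \<Rightarrow> real" where "h t = \<eta> * real t powr (-3/4)"

lemma \<alpha>_bounds: "0 \<le> \<alpha> t" "\<alpha> t \<le> 1"
  unfolding \<alpha>_def by (cases "t = 0"; use powr_mono[of "-1/2" 0 "real t"] in simp)+

lemma h_nonneg: "0 \<le> h t"
  using \<eta> by (simp add: h_def)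

lemma iterates:
  assumes "\<omega> \<in> space M"
  shows "x (Suc 0) \<omega> = x1" and "g 0 \<omega> = 0"
    and "g (Suc t) \<omega> = (1 - \<alpha> (Suc t)) *\<^sub>R g t \<omega> + \<alpha> (Suc t) *\<^sub>R df (x (Suc t) \<omega>) (\<xi> (Suc t) \<omega>)"
    and "x (Suc (Suc t)) \<omega> = x (Suc t) \<omega> - h (Suc t) *\<^sub>R sgn (g (Suc t) \<omega>)"
  using run assms by (auto simp: nsgd_run_def nsgd_iterates_def \<alpha>_def h_def)

text \<open>The recursion of \<open>g\<close> driven by the oracle error instead of the oracle. The
  drift gets no name of its own: it is what remains of the estimation error after subtracting
  \<open>noise\<close>.\<close>

primrec noise :: "nat \<Rightarrow> 'w \<Rightarrow> 'a" where
  "noise 0 \<omega> = 0"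
| "noise (Suc t) \<omega> = (1 - \<alpha> (Suc t)) *\<^sub>R noise t \<omega>
      + \<alpha> (Suc t) *\<^sub>R (df (x (Suc t) \<omega>) (\<xi> (Suc t) \<omega>) - gradient F (x (Suc t) \<omega>))"

definition history :: "nat \<Rightarrow> 'w \<Rightarrow> nat \<Rightarrow> 'xi" where
  "history t \<omega> = restrict (\<lambda>i. \<xi> i \<omega>) {Suc 0..t}"

text \<open>The next iterate, the momentum and the noise are carried together because each update
  uses the others. The index shift matters: \<open>x (Suc t)\<close> is fixed by the first
  \<open>t\<close> samples, hence by data independent of sample \<open>Suc t\<close>.\<close>

lemma state_from_history:
  obtains \<Phi> where "\<Phi> \<in> PiM {Suc 0..t} (\<lambda>_. D) \<rightarrow>\<^sub>M (borel \<Otimes>\<^sub>M borel \<Otimes>\<^sub>M borel)"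
    and "\<And>\<omega>. \<omega> \<in> space M \<Longrightarrow> \<Phi> (history t \<omega>) = (x (Suc t) \<omega>, g t \<omega>, noise t \<omega>)"
proof (atomize_elim, induction t)
  case 0
  show ?case
    by (rule exI[of _ "\<lambda>_. (x1, 0, 0)"]) (auto simp: iterates)
next
  case (Suc t)
  then obtain \<Phi> where [measurable]: "\<Phi> \<in> PiM {Suc 0..t} (\<lambda>_. D) \<rightarrow>\<^sub>M (borel \<Otimes>\<^sub>M borel \<Otimes>\<^sub>M borel)"
    and \<Phi>: "\<And>\<omega>. \<omega> \<in> space M \<Longrightarrow> \<Phi> (history t \<omega>) = (x (Suc t) \<omega>, g t \<omega>, noise t \<omega>)"
    by blast
  define G where "G z = (1 - \<alpha> (Suc t)) *\<^sub>R fst (snd (fst z)) + \<alpha> (Suc t) *\<^sub>R df (fst (fst z)) (snd z)"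
    for z :: "('a \<times> 'a \<times> 'a) \<times> 'xi"
  define \<Psi> where "\<Psi> z = (fst (fst z) - h (Suc t) *\<^sub>R sgn (G z), G z,
      (1 - \<alpha> (Suc t)) *\<^sub>R snd (snd (fst z))
        + \<alpha> (Suc t) *\<^sub>R (df (fst (fst z)) (snd z) - gradient F (fst (fst z))))"
    for z :: "('a \<times> 'a \<times> 'a) \<times> 'xi"
  have [measurable]: "G \<in> (borel \<Otimes>\<^sub>M borel \<Otimes>\<^sub>M borel) \<Otimes>\<^sub>M D \<rightarrow>\<^sub>M borel"
    unfolding G_def[abs_def] by measurable
  have [measurable]: "\<Psi> \<in> (borel \<Otimes>\<^sub>M borel \<Otimes>\<^sub>M borel) \<Otimes>\<^sub>M D \<rightarrow>\<^sub>M (borel \<Otimes>\<^sub>M borel \<Otimes>\<^sub>M borel)"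
    unfolding \<Psi>_def[abs_def] by measurable
  have [measurable]: "(\<lambda>w. restrict w {Suc 0..t}) \<in> PiM {Suc 0..Suc t} (\<lambda>_. D) \<rightarrow>\<^sub>M PiM {Suc 0..t} (\<lambda>_. D)"
    by (rule measurable_restrict_subset) auto
  have [measurable]: "(\<lambda>w. w (Suc t)) \<in> PiM {Suc 0..Suc t} (\<lambda>_. D) \<rightarrow>\<^sub>M D"
    by (rule measurable_component_singleton) auto
  show ?case
  proof (intro exI[of _ "\<lambda>w. \<Psi> (\<Phi> (restrict w {Suc 0..t}), w (Suc t))"] conjI allI impI)
    show "(\<lambda>w. \<Psi> (\<Phi> (restrict w {Suc 0..t}), w (Suc t)))
        \<in> PiM {Suc 0..Suc t} (\<lambda>_. D) \<rightarrow>\<^sub>M (borel \<Otimes>\<^sub>M borel \<Otimes>\<^sub>M borel)"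
      by measurable
    fix \<omega> assume \<omega>: "\<omega> \<in> space M"
    have "restrict (history (Suc t) \<omega>) {Suc 0..t} = history t \<omega>" "history (Suc t) \<omega> (Suc t) = \<xi> (Suc t) \<omega>"
      by (auto simp: history_def fun_eq_iff)
    then show "\<Psi> (\<Phi> (restrict (history (Suc t) \<omega>) {Suc 0..t}), history (Suc t) \<omega> (Suc t))
        = (x (Suc (Suc t)) \<omega>, g (Suc t) \<omega>, noise (Suc t) \<omega>)"
      using \<omega> by (simp add: \<Psi>_def G_def \<Phi> iterates)
  qed
qed

section \<open>Measurability, and independence of the fresh sample from the past\<close>

lemma measurable_history [measurable]: "history t \<in> M \<rightarrow>\<^sub>M PiM {Suc 0..t} (\<lambda>_. D)"
  unfolding history_def[abs_def]
  using indep_samples by (intro measurable_restrict) (auto simp: indep_vars_def)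

lemma measurable_iterate [measurable]: "x (Suc t) \<in> borel_measurable M"
  and measurable_noise [measurable]: "noise t \<in> borel_measurable M"
proof -
  obtain \<Phi> where [measurable]: "\<Phi> \<in> PiM {Suc 0..t} (\<lambda>_. D) \<rightarrow>\<^sub>M (borel \<Otimes>\<^sub>M borel \<Otimes>\<^sub>M borel)"
    and \<Phi>: "\<And>\<omega>. \<omega> \<in> space M \<Longrightarrow> \<Phi> (history t \<omega>) = (x (Suc t) \<omega>, g t \<omega>, noise t \<omega>)"
    using state_from_history by blast
  have "(\<lambda>\<omega>. fst (\<Phi> (history t \<omega>))) \<in> borel_measurable M"
    "(\<lambda>\<omega>. snd (snd (\<Phi> (history t \<omega>)))) \<in> borel_measurable M"
    by measurable
  then show "x (Suc t) \<in> borel_measurable M" "noise t \<in> borel_measurable M"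
    by (simp_all add: \<Phi> cong: measurable_cong)
qed

lemma measurable_sample [measurable]: "\<xi> (Suc t) \<in> M \<rightarrow>\<^sub>M D"
  using indep_samples by (auto simp: indep_vars_def)

lemma distr_history_sample:
  "distr M (PiM {Suc 0..t} (\<lambda>_. D) \<Otimes>\<^sub>M D) (\<lambda>\<omega>. (history t \<omega>, \<xi> (Suc t) \<omega>))
    = distr M (PiM {Suc 0..t} (\<lambda>_. D)) (history t) \<Otimes>\<^sub>M D"
proof -
  \<comment> \<open>\<open>indep_var\<close> needs both variables to have one type, so \<open>\<xi> (Suc t)\<close> is treated as a family over
    \<open>{Suc t}\<close> first and projected afterwards\<close>
  let ?P = "PiM {Suc 0..t} (\<lambda>_. D)" and ?Q = "PiM {Suc t} (\<lambda>_. D)"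
  define R where "R \<omega> = restrict (\<lambda>i. \<xi> i \<omega>) {Suc t}" for \<omega>
  have [measurable]: "R \<in> M \<rightarrow>\<^sub>M ?Q"
    unfolding R_def[abs_def] by (intro measurable_restrict) auto
  have [measurable]: "(\<lambda>w. w (Suc t)) \<in> ?Q \<rightarrow>\<^sub>M D"
    by (rule measurable_component_singleton) auto
  have "indep_var ?P (history t) ?Q R"
    unfolding history_def[abs_def] R_def[abs_def]
    by (rule indep_var_restrict[OF indep_samples]) auto
  then have ind: "distr M ?P (history t) \<Otimes>\<^sub>M distr M ?Q R = distr M (?P \<Otimes>\<^sub>M ?Q) (\<lambda>\<omega>. (history t \<omega>, R \<omega>))"
    by (simp add: indep_var_distribution_eq)
  have D: "distr (distr M ?Q R) D (\<lambda>w. w (Suc t)) = D"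
    using distr_sample[of "Suc t"] by (simp add: distr_distr o_def R_def)
  have proj: "(\<lambda>(u, w). (u, w (Suc t))) \<circ> (\<lambda>\<omega>. (history t \<omega>, R \<omega>)) = (\<lambda>\<omega>. (history t \<omega>, \<xi> (Suc t) \<omega>))"
    by (simp add: fun_eq_iff R_def)
  have "distr M ?P (history t) \<Otimes>\<^sub>M D
    = distr (distr M ?P (history t)) ?P (\<lambda>w. w) \<Otimes>\<^sub>M distr (distr M ?Q R) D (\<lambda>w. w (Suc t))"
    unfolding D by (simp add: distr_id2)
  also have "\<dots> = distr (distr M ?P (history t) \<Otimes>\<^sub>M distr M ?Q R) (?P \<Otimes>\<^sub>M D) (\<lambda>(u, w). (u, w (Suc t)))"
    by (intro pair_measure_distr) (auto simp: D prob_space_imp_sigma_finite prob_space_D)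
  also have "\<dots> = distr M (?P \<Otimes>\<^sub>M D) (\<lambda>\<omega>. (history t \<omega>, \<xi> (Suc t) \<omega>))"
    unfolding ind by (subst distr_distr) (measurable, simp only: proj)
  finally show ?thesis ..
qed

section \<open>Moments of the noise\<close>

primrec moment :: "nat \<Rightarrow> real" where
  "moment 0 = 0"
| "moment (Suc t) = (1 - \<alpha> (Suc t)) powr p * moment t + 6 * \<alpha> (Suc t) powr p * \<sigma> powr p"

lemma moment_nonneg: "0 \<le> moment t"
  by (induction t) auto

text \<open>Given the history, the old noise and the query point are constants, and the oracle error
  is centered with \<open>p\<close>-th moment at most \<open>\<sigma> powr p\<close>. The real
  sequence \<open>moment\<close> keeps track of finiteness and hands the recursion over to real
  analysis.\<close>

lemma noise_moment_le: "(\<integral>\<^sup>+ \<omega>. norm (noise t \<omega>) powr p \<partial>M) \<le> ennreal (moment t)"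
proof (induction t)
  case (Suc t)
  obtain \<Phi> where [measurable]: "\<Phi> \<in> PiM {Suc 0..t} (\<lambda>_. D) \<rightarrow>\<^sub>M (borel \<Otimes>\<^sub>M borel \<Otimes>\<^sub>M borel)"
    and \<Phi>: "\<And>\<omega>. \<omega> \<in> space M \<Longrightarrow> \<Phi> (history t \<omega>) = (x (Suc t) \<omega>, g t \<omega>, noise t \<omega>)"
    using state_from_history by blast
  define c where "c w = (1 - \<alpha> (Suc t)) *\<^sub>R snd (snd (\<Phi> w))" for w
  define n where "n w s = df (fst (\<Phi> w)) s - gradient F (fst (\<Phi> w))" for w s
  interpret D: prob_space D
    by (rule prob_space_D)
  have "(\<integral>\<^sup>+ \<omega>. norm (noise (Suc t) \<omega>) powr p \<partial>M)
    = (\<integral>\<^sup>+ \<omega>. norm (c (history t \<omega>) + \<alpha> (Suc t) *\<^sub>R n (history t \<omega>) (\<xi> (Suc t) \<omega>)) powr p \<partial>M)"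
    by (intro nn_integral_cong) (simp add: c_def n_def \<Phi>)
  also have "\<dots> \<le> (\<integral>\<^sup>+ \<omega>. norm (c (history t \<omega>)) powr p \<partial>M)
      + ennreal (6 * \<alpha> (Suc t) powr p * \<sigma> powr p)"
  proof (rule nn_integral_norm_add_indep_powr_le[OF p _ _ measurable_history measurable_sample
        prob_space_D distr_history_sample])
    show "c \<in> borel_measurable (PiM {Suc 0..t} (\<lambda>_. D))"
      unfolding c_def[abs_def] by measurable
    show "case_prod n \<in> borel_measurable (PiM {Suc 0..t} (\<lambda>_. D) \<Otimes>\<^sub>M D)"
      unfolding n_def[abs_def] by measurable
  qed (use stoch_gradient \<alpha>_bounds in \<open>auto simp: n_def D.prob_space\<close>)
  also have "(\<integral>\<^sup>+ \<omega>. norm (c (history t \<omega>)) powr p \<partial>M)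
      = (\<integral>\<^sup>+ \<omega>. ennreal ((1 - \<alpha> (Suc t)) powr p) * ennreal (norm (noise t \<omega>) powr p) \<partial>M)"
    using \<alpha>_bounds
    by (intro nn_integral_cong) (simp add: c_def \<Phi> powr_mult flip: ennreal_mult)
  also have "\<dots> = ennreal ((1 - \<alpha> (Suc t)) powr p) * (\<integral>\<^sup>+ \<omega>. norm (noise t \<omega>) powr p \<partial>M)"
    by (rule nn_integral_cmult) measurable
  also have "\<dots> \<le> ennreal ((1 - \<alpha> (Suc t)) powr p) * ennreal (moment t)"
    by (intro mult_left_mono Suc.IH) auto
  finally show ?case
    using moment_nonneg by (simp add: ennreal_mult ennreal_plus add_right_mono)
qed (use p in simp)

lemma expected_noise:
  assumes t: "1 \<le> t"
  shows "integrable M (\<lambda>\<omega>. norm (noise t \<omega>))"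
    and "expectation (\<lambda>\<omega>. norm (noise t \<omega>)) \<le> 12 * \<sigma> * real t powr (- (p - 1) / (2 * p))"
proof -
  define c where "c = 12 * \<sigma> * real t powr (- (p - 1) / (2 * p))"
  have "moment t \<le> 12 * \<sigma> powr p * real t powr (- (p - 1) / 2)"
  proof (rule momentum_moment_recursion[OF p _ _ t])
    fix s :: nat assume "1 \<le> s"
    then show "moment s \<le> (1 - real s powr (-1/2)) powr p * moment (s - 1)
        + 6 * (real s powr (-1/2)) powr p * \<sigma> powr p"
      by (cases s) (auto simp: \<alpha>_def)
  qed simp
  \<comment> \<open>Enlarging 12 to \<open>12 powr p\<close> makes the bound the \<open>p\<close>-th
    power of \<open>c\<close>.\<close>
  also have "\<dots> \<le> 12 powr p * \<sigma> powr p * real t powr (- (p - 1) / 2)"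
    using powr_mono[of 1 p 12] p by (intro mult_right_mono) auto
  also have "\<dots> = c powr p"
    using p \<sigma>_nonneg by (simp add: c_def powr_mult powr_powr)
  finally have "(\<integral>\<^sup>+ \<omega>. norm (noise t \<omega>) powr p \<partial>M) \<le> ennreal (c powr p)"
    using noise_moment_le[of t] by (meson ennreal_leI order_trans)
  then show "integrable M (\<lambda>\<omega>. norm (noise t \<omega>))" "expectation (\<lambda>\<omega>. norm (noise t \<omega>)) \<le> c"
    using expectation_le_of_powr_moment[OF p(1), of c "\<lambda>\<omega>. norm (noise t \<omega>)"] \<sigma>_nonneg
    by (auto simp: c_def)
qed

section \<open>Bounds that hold for every sample path\<close>

lemma gradient_dist: "norm (gradient F y - gradient F z) \<le> L * norm (y - z)"
  using lipschitz_onD[OF lipschitz, of y z] by (simp add: dist_norm)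

lemma gradient_step:
  assumes "\<omega> \<in> space M"
  shows "norm (gradient F (x (Suc t) \<omega>) - gradient F (x (Suc (Suc t)) \<omega>)) \<le> L * h (Suc t)"
proof -
  have "norm (x (Suc t) \<omega> - x (Suc (Suc t)) \<omega>) \<le> h (Suc t)"
    using assms h_nonneg[of "Suc t"] by (simp add: iterates norm_sgn)
  then show ?thesis
    using gradient_dist L_nonneg by (meson mult_left_mono order_trans)
qed

text \<open>Subtracting \<open>noise\<close> cancels the oracle: the drift at \<open>s\<close> is
  \<open>1 - \<alpha> s\<close> times the sum of the previous drift and the gradient change over one
  step. A step has length at most \<open>h\<close>, so no expectation is involved.\<close>

lemma drift_le:
  assumes \<omega>: "\<omega> \<in> space M" and t: "1 \<le> t"
  shows "norm (g t \<omega> - gradient F (x t \<omega>) - noise t \<omega>) \<le> 4 * (L * \<eta>) * real t powr (-1/4)"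
proof (rule momentum_drift_recursion[OF _ _ t])
  show "0 \<le> L * \<eta>"
    using L_nonneg \<eta> by simp
  fix s :: nat assume "1 \<le> s"
  then obtain r where r: "s = Suc r"
    by (cases s) auto
  show "norm (g s \<omega> - gradient F (x s \<omega>) - noise s \<omega>)
    \<le> (1 - real s powr (-1/2)) * (norm (g (s - 1) \<omega> - gradient F (x (s - 1) \<omega>) - noise (s - 1) \<omega>)
      + L * \<eta> * real (s - 1) powr (-3/4))"
  proof (cases r)
    case 0 \<comment> \<open>\<open>\<alpha> 1 = 1\<close>, so the unspecified \<open>x 0\<close> does not enter\<close>
    then show ?thesis
      using \<omega> by (simp add: r iterates \<alpha>_def algebra_simps)
  next
    case (Suc q)
    have "g s \<omega> - gradient F (x s \<omega>) - noise s \<omega>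
      = (1 - \<alpha> s) *\<^sub>R ((g r \<omega> - gradient F (x r \<omega>) - noise r \<omega>) + (gradient F (x r \<omega>) - gradient F (x s \<omega>)))"
      using \<omega> by (simp add: r iterates(3) algebra_simps)
    then have "norm (g s \<omega> - gradient F (x s \<omega>) - noise s \<omega>)
      = (1 - \<alpha> s) * norm ((g r \<omega> - gradient F (x r \<omega>) - noise r \<omega>) + (gradient F (x r \<omega>) - gradient F (x s \<omega>)))"
      using \<alpha>_bounds by simp
    also have "\<dots> \<le> (1 - \<alpha> s) * (norm (g r \<omega> - gradient F (x r \<omega>) - noise r \<omega>) + L * h r)"
      using gradient_step[OF \<omega>, of q] \<alpha>_bounds
      by (intro mult_left_mono norm_triangle_le add_left_mono) (auto simp: r Suc)
    finally show ?thesis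
      by (simp add: r \<alpha>_def h_def mult_ac)
  qed
qed

text \<open>The start is deterministic and every step has bounded length. With the Lipschitz
  gradient this yields integrability of the gradient norms.\<close>

lemma bounded_iterate: "\<exists>B. \<forall>\<omega>\<in>space M. norm (x (Suc t) \<omega>) \<le> B"
proof (induction t)
  case (Suc t)
  then obtain B where B: "\<And>\<omega>. \<omega> \<in> space M \<Longrightarrow> norm (x (Suc t) \<omega>) \<le> B"
    by blast
  have "norm (x (Suc (Suc t)) \<omega>) \<le> B + h (Suc t)" if \<omega>: "\<omega> \<in> space M" for \<omega>
  proof -
    have "norm (h (Suc t) *\<^sub>R sgn (g (Suc t) \<omega>)) \<le> h (Suc t)"
      using h_nonneg[of "Suc t"] by (simp add: norm_sgn)
    then show ?thesis
      unfolding iterates(4)[OF \<omega>] using B[OF \<omega>] norm_triangle_ineq4 by (meson add_mono order_trans)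
  qed
  then show ?case
    by blast
qed (auto simp: iterates)

lemma integrable_gradient:
  assumes "1 \<le> t"
  shows "integrable M (\<lambda>\<omega>. norm (gradient F (x t \<omega>)))"
proof -
  obtain s where t: "t = Suc s"
    using assms by (cases t) auto
  obtain B where B: "\<And>\<omega>. \<omega> \<in> space M \<Longrightarrow> norm (x t \<omega>) \<le> B"
    using bounded_iterate t by blast
  have "norm (gradient F (x t \<omega>)) \<le> norm (gradient F 0) + L * B" if "\<omega> \<in> space M" for \<omega>
  proof -
    have "norm (gradient F (x t \<omega>) - gradient F 0) \<le> L * B"
      using gradient_dist[of "x t \<omega>" 0] mult_left_mono[OF B[OF that] L_nonneg] by simp
    then show ?thesis
      using norm_triangle_sub[of "gradient F (x t \<omega>)" "gradient F 0"] by linarith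
  qed
  then show ?thesis
    by (intro integrable_const_bound[of _ "norm (gradient F 0) + L * B"])
      (auto simp: t intro!: AE_I2)
qed

text \<open>The descent inequality is telescoped path by path, before expectations are taken, so the
  values of \<open>F\<close> are gone and only gradient and noise norms are integrated.\<close>

lemma weighted_gradients_le:
  assumes \<omega>: "\<omega> \<in> space M"
  shows "(\<Sum>t=1..T. h t * norm (gradient F (x t \<omega>)))
    \<le> \<Delta> + (\<Sum>t=1..T. 2 * h t * (norm (noise t \<omega>) + 4 * (L * \<eta>) * real t powr (-1/4)) + L * (h t)\<^sup>2)"
proof -
  have "(\<Sum>t=1..T. h t * norm (gradient F (x t \<omega>)))
    \<le> F x1 - F (x (Suc T) \<omega>)
      + (\<Sum>t=1..T. 2 * h t * (norm (noise t \<omega>) + 4 * (L * \<eta>) * real t powr (-1/4)) + L * (h t)\<^sup>2)"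
  proof (induction T)
    case (Suc T)
    let ?t = "Suc T"
    have "norm (g ?t \<omega> - gradient F (x ?t \<omega>))
      \<le> norm (noise ?t \<omega>) + norm (g ?t \<omega> - gradient F (x ?t \<omega>) - noise ?t \<omega>)"
      by (rule norm_triangle_sub)
    also have "\<dots> \<le> norm (noise ?t \<omega>) + 4 * (L * \<eta>) * real ?t powr (-1/4)"
      using drift_le[OF \<omega>, of ?t] by simp
    finally have "2 * h ?t * norm (g ?t \<omega> - gradient F (x ?t \<omega>))
      \<le> 2 * h ?t * (norm (noise ?t \<omega>) + 4 * (L * \<eta>) * real ?t powr (-1/4))"
      using h_nonneg by (intro mult_left_mono) auto
    moreover have "h ?t * norm (gradient F (x ?t \<omega>)) \<le> F (x ?t \<omega>) - F (x (Suc ?t) \<omega>)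
      + 2 * h ?t * norm (g ?t \<omega> - gradient F (x ?t \<omega>)) + L * (h ?t)\<^sup>2"
      using normalized_step_descent[OF smooth h_nonneg, of ?t "x ?t \<omega>" "g ?t \<omega>"] \<omega>
      by (simp only: iterates(4))
    moreover have "(\<Sum>t=1..Suc T. f t) = (\<Sum>t=1..T. f t) + f (Suc T)" for f :: "nat \<Rightarrow> real"
      by simp
    ultimately show ?case
      using Suc.IH by (simp only:)
  qed (use \<omega> in \<open>simp add: iterates\<close>)
  moreover have "F x1 - F (x (Suc T) \<omega>) \<le> \<Delta>"
    using run unfolding nsgd_run_def by (smt (verit))
  ultimately show ?thesis
    by linarith
qed

lemma avg_grad_norm_le:
  assumes T: "3 \<le> T"
  shows "avg_grad_norm M F x T \<le> nsgd_bound \<eta> p \<Delta> L \<sigma> T"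
proof -
  define E where "E t = expectation (\<lambda>\<omega>. norm (gradient F (x t \<omega>)))" for t
  define N where "N = noise_growth p (real T)"
  define q where "q = (2 - p) / (4 * p)"
  have T1: "1 \<le> ln (real T)" "1 \<le> N"
    using ln_nat_ge_one[OF T] noise_growth_lower[OF p, of "real T"] T by (auto simp: N_def)
  have E: "0 \<le> E t" for t
    by (simp add: E_def)
  define R where "R t \<omega> = 2 * h t * (norm (noise t \<omega>) + 4 * (L * \<eta>) * real t powr (-1/4))
      + L * (h t)\<^sup>2" for t \<omega>
  have R: "integrable M (R t)" "expectation (R t) = 2 * h t * (expectation (\<lambda>\<omega>. norm (noise t \<omega>))
      + 4 * (L * \<eta>) * real t powr (-1/4)) + L * (h t)\<^sup>2" if "t \<in> {1..T}" for t
    using that expected_noise(1)[of t] unfolding R_def[abs_def] by (auto simp: prob_space)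
  have "(\<Sum>t=1..T. h t * E t) = expectation (\<lambda>\<omega>. \<Sum>t=1..T. h t * norm (gradient F (x t \<omega>)))"
    unfolding E_def by (subst Bochner_Integration.integral_sum) (auto intro: integrable_gradient)
  also have "\<dots> \<le> expectation (\<lambda>\<omega>. \<Delta> + (\<Sum>t=1..T. R t \<omega>))"
    unfolding R_def
    by (intro integral_mono weighted_gradients_le Bochner_Integration.integrable_add
        Bochner_Integration.integrable_sum integrable_mult_right integrable_const)
      (auto intro: integrable_gradient expected_noise)
  also have "\<dots> = \<Delta> + (\<Sum>t=1..T. expectation (R t))"
    using R(1) Bochner_Integration.integral_sum[of "{1..T}" M R]
    by (subst Bochner_Integration.integral_add)
      (auto simp: prob_space intro!: Bochner_Integration.integrable_sum)
  also have "\<dots> = \<Delta> + (\<Sum>t=1..T. 2 * h t * (expectation (\<lambda>\<omega>. norm (noise t \<omega>))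
      + 4 * (L * \<eta>) * real t powr (-1/4)) + L * (h t)\<^sup>2)"
    using R(2) by simp
  \<comment> \<open>The 24 is 2 times the 12 of \<open>expected_noise\<close>; the 9 is 8 from the
    drift plus 1 from the quadratic term, whose \<open>t powr (-3/2)\<close> is relaxed to
    \<open>t powr -1\<close>.\<close>
  also have "\<dots> \<le> \<Delta> + (\<Sum>t=1..T. 24 * (\<eta> * \<sigma>) * real t powr (q - 1) + 9 * (\<eta>\<^sup>2 * L) * real t powr - 1)"
  proof (intro add_left_mono sum_mono)
    fix t assume "t \<in> {1..T}"
    then have t: "1 \<le> t"
      by simp
    have "2 * h t * expectation (\<lambda>\<omega>. norm (noise t \<omega>))
      \<le> 2 * h t * (12 * \<sigma> * real t powr (- (p - 1) / (2 * p)))"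
      using expected_noise(2)[OF t] h_nonneg by (intro mult_left_mono) auto
    also have "\<dots> = 24 * (\<eta> * \<sigma>) * real t powr (-3/4 + - (p - 1) / (2 * p))"
      unfolding h_def powr_add by simp
    also have "-3/4 + - (p - 1) / (2 * p) = q - 1"
      using p by (simp add: q_def field_simps)
    finally have 1: "2 * h t * expectation (\<lambda>\<omega>. norm (noise t \<omega>)) \<le> 24 * (\<eta> * \<sigma>) * real t powr (q - 1)" .
    have "real t powr -1 = real t powr (-3/4) * real t powr (-1/4)"
      by (simp flip: powr_add)
    then have 2: "2 * h t * (4 * (L * \<eta>) * real t powr (-1/4)) = 8 * (\<eta>\<^sup>2 * L) * real t powr -1"
      by (simp add: h_def power2_eq_square)
    have "(h t)\<^sup>2 = \<eta>\<^sup>2 * real t powr (-3/2)"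
      using t by (simp add: h_def power_mult_distrib flip: powr_numeral add: powr_powr)
    also have "\<dots> \<le> \<eta>\<^sup>2 * real t powr -1"
      using t by (intro mult_left_mono powr_mono) auto
    finally have "L * (h t)\<^sup>2 \<le> L * (\<eta>\<^sup>2 * real t powr -1)"
      using L_nonneg by (rule mult_left_mono)
    then have 3: "L * (h t)\<^sup>2 \<le> (\<eta>\<^sup>2 * L) * real t powr -1"
      by (simp only: mult_ac)
    show "2 * h t * (expectation (\<lambda>\<omega>. norm (noise t \<omega>)) + 4 * (L * \<eta>) * real t powr (-1/4)) + L * (h t)\<^sup>2
      \<le> 24 * (\<eta> * \<sigma>) * real t powr (q - 1) + 9 * (\<eta>\<^sup>2 * L) * real t powr - 1"
      unfolding distrib_left using 1 2 3 by linarith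
  qed
  also have "\<dots> = \<Delta> + 24 * (\<eta> * \<sigma>) * (\<Sum>t=1..T. real t powr (q - 1))
      + 9 * (\<eta>\<^sup>2 * L) * (\<Sum>t=1..T. real t powr - 1)"
    by (simp add: sum.distrib sum_distrib_left)
  \<comment> \<open>Both \<open>N\<close> and \<open>ln T\<close> are at least 1 for
    \<open>3 \<le> T\<close>, so the first summand is absorbed by doubling.\<close>
  also have "\<dots> \<le> \<Delta> + 24 * (\<eta> * \<sigma>) * (2 * N) + 9 * (\<eta>\<^sup>2 * L) * (2 * ln (real T))"
  proof (intro add_mono mult_left_mono order_refl)
    show "(\<Sum>t=1..T. real t powr (q - 1)) \<le> 2 * N"
      using sum_powr_le_noise_growth[of p T] p T T1(2) by (simp add: q_def N_def)
    show "(\<Sum>t=1..T. real t powr - 1) \<le> 2 * ln (real T)"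
      using sum_powr_le_noise_growth[of 2 T] T T1(1) by (simp add: noise_growth_def)
  qed (use \<eta> \<sigma>_nonneg L_nonneg in auto)
  \<comment> \<open>The constants obtained are 48 and 18; 120 leaves room.\<close>
  also have "\<dots> \<le> \<Delta> + 120 * (\<eta> * \<sigma>) * N + 120 * (\<eta>\<^sup>2 * L) * ln (real T)"
  proof -
    have "0 \<le> \<eta> * \<sigma> * N" "0 \<le> \<eta>\<^sup>2 * L * ln (real T)"
      using \<eta> \<sigma>_nonneg L_nonneg T1 by auto
    then show ?thesis
      by linarith
  qed
  also have "\<dots> = \<eta> * (\<Delta> / \<eta> + 120 * \<eta> * L * ln (real T) + 120 * \<sigma> * N)"
    using \<eta> by (simp add: field_simps power2_eq_square)
  finally have weighted: "(\<Sum>t=1..T. h t * E t)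
    \<le> \<eta> * (\<Delta> / \<eta> + 120 * \<eta> * L * ln (real T) + 120 * \<sigma> * N)" .
  \<comment> \<open>The weights \<open>h t\<close> decrease, so the last one bounds all from below.
    Dividing by it and by \<open>T\<close> leaves the factor \<open>T powr (-1/4)\<close>.\<close>
  have "\<eta> * real T powr (-3/4) * (\<Sum>t=1..T. E t) \<le> (\<Sum>t=1..T. h t * E t)"
    unfolding sum_distrib_left h_def
    using \<eta> E by (intro sum_mono mult_right_mono mult_left_mono powr_mono2') auto
  from order_trans[OF this weighted] have "real T powr (-3/4) * (\<Sum>t=1..T. E t)
    \<le> \<Delta> / \<eta> + 120 * \<eta> * L * ln (real T) + 120 * \<sigma> * N"
    using \<eta> by (simp only: mult.assoc mult_le_cancel_left_pos)
  then have "real T powr (-1/4) * (real T powr (-3/4) * (\<Sum>t=1..T. E t))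
    \<le> real T powr (-1/4) * (\<Delta> / \<eta> + 120 * \<eta> * L * ln (real T) + 120 * \<sigma> * N)"
    by (rule mult_left_mono) simp
  moreover have "real T powr (-1/4) * real T powr (-3/4) = 1 / real T"
    using T by (simp add: powr_minus_divide flip: powr_add)
  ultimately show ?thesis
    unfolding avg_grad_norm_def nsgd_bound_def E_def[symmetric] N_def[symmetric]
    by (simp add: powr_minus_divide mult.assoc[symmetric])
qed

end

subsection \<open>Sample complexity\<close>

lemma mult_powr_minus_inverse_le_one:
  fixes z s Y :: real
  assumes "0 < s" "0 < Y" and z: "0 \<le> z" "z powr s \<le> Y"
  shows "z * Y powr (- (1 / s)) \<le> 1"
proof -
  have "z = (z powr s) powr (1 / s)"
    using assms by (simp add: powr_powr)
  also have "\<dots> \<le> Y powr (1 / s)"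
    using assms by (intro powr_mono2) auto
  finally have "z * Y powr (- (1 / s)) \<le> Y powr (1 / s) * Y powr (- (1 / s))"
    by (rule mult_right_mono) simp
  then show ?thesis
    using assms by (simp flip: powr_add)
qed

lemma add_power4_le:
  fixes a b :: real
  shows "(a + b) ^ 4 \<le> 8 * (a ^ 4 + b ^ 4)"
proof -
  have sq: "(u + v)\<^sup>2 \<le> 2 * (u\<^sup>2 + v\<^sup>2)" for u v :: real
    using sum_squares_bound[of u v] by (simp add: power2_sum)
  have "(a + b) ^ 4 = ((a + b)\<^sup>2)\<^sup>2"
    by simp
  also have "\<dots> \<le> (2 * (a\<^sup>2 + b\<^sup>2))\<^sup>2"
    using sq by (intro power_mono) auto
  also have "\<dots> = 4 * (a\<^sup>2 + b\<^sup>2)\<^sup>2"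
    by (simp only: power_mult_distrib) simp
  also have "\<dots> \<le> 4 * (2 * ((a\<^sup>2)\<^sup>2 + (b\<^sup>2)\<^sup>2))"
    by (intro mult_left_mono sq) auto
  finally show ?thesis
    by simp
qed

lemma ln_inverse_at_top: "filterlim (\<lambda>\<epsilon>::real. ln (1 / \<epsilon>)) at_top (at_right 0)"
  using filterlim_compose[OF ln_at_top filterlim_inverse_at_top_right] by (simp add: inverse_eq_divide)

lemma ln_power_mult_tendsto_0: "((\<lambda>\<epsilon>::real. ln (1 / \<epsilon>) ^ k * \<epsilon>) \<longlongrightarrow> 0) (at_right 0)"
proof (rule Lim_transform_eventually)
  show "((\<lambda>\<epsilon>::real. ln (1 / \<epsilon>) ^ k / exp (ln (1 / \<epsilon>))) \<longlongrightarrow> 0) (at_right 0)"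
    by (rule filterlim_compose[OF tendsto_power_div_exp_0 ln_inverse_at_top])
  show "\<forall>\<^sub>F \<epsilon>::real in at_right 0. ln (1 / \<epsilon>) ^ k / exp (ln (1 / \<epsilon>)) = ln (1 / \<epsilon>) ^ k * \<epsilon>"
    by (rule eventually_at_right_less[THEN eventually_mono]) simp
qed

text \<open>The number \<open>l\<close> stands for an a priori bound on \<open>ln Y\<close>. By
  monotonicity both parts of the soft rate may be evaluated at \<open>Y\<close> instead of
  \<open>T\<close>; there \<open>l\<close> replaces the logarithm, and \<open>Y1\<close> and
  \<open>Y2\<close> make each part at most \<open>\<epsilon> / 2\<close>.\<close>

lemma nsgd_bound_le_of_large:
  fixes T :: nat
  assumes p: "1 < p" "p \<le> 2" and \<eta>: "0 < \<eta>"
    and nonneg: "0 \<le> \<Delta>" "0 \<le> L" "0 \<le> \<sigma>"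
    and r: "r = 2 * p / (p - 1)" and C: "C = 1 / \<eta> + 120 * \<eta> + 120" and l: "0 \<le> l"
    and Y: "exp r \<le> Y" "ln Y \<le> l" and T: "Y \<le> real T" and \<epsilon>: "0 < \<epsilon>"
    and Y1: "(2 * C * l * (\<Delta> + L) / \<epsilon>) ^ 4 \<le> Y"
    and Y2: "(2 * C * l * \<sigma> / \<epsilon>) powr r \<le> Y"
  shows "nsgd_bound \<eta> p \<Delta> L \<sigma> T \<le> \<epsilon>"
proof -
  have r4: "4 \<le> r" and rinv: "- (p - 1) / (2 * p) = - (1 / r)"
    using p by (auto simp: r field_simps)
  have "exp 4 \<le> exp r"
    using r4 by simp
  then have Y4: "exp 4 \<le> Y"
    using Y by linarith
  have Ypos: "0 < Y"
    using Y4 exp_gt_zero[of 4] by linarith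
  have C1: "0 \<le> C"
    using \<eta> by (simp add: C)
  have T3: "3 \<le> T"
    using T Y4 exp_ge_add_one_self[of 4] by linarith
  \<comment> \<open>Used with \<open>s = 4\<close> for \<open>\<Delta> + L\<close> and
    \<open>s = r\<close> for \<sigma>; since \<open>4 \<le> r\<close>, the hypothesis
    \<open>exp r \<le> Y\<close> serves both.\<close>
  have *: "C * ln (real T) * (a * real T powr (- (1 / s))) \<le> \<epsilon> / 2"
    if a: "0 \<le> a" and s: "0 < s" "exp s \<le> Y" and z: "(2 * C * l * a / \<epsilon>) powr s \<le> Y" for a s
  proof -
    have "C * ln (real T) * (a * real T powr (- (1 / s))) = C * a * (ln (real T) * real T powr (- (1 / s)))"
      by simp
    also have "\<dots> \<le> C * a * (ln Y * Y powr (- (1 / s)))"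
      using a C1 ln_mult_powr_antimono[OF s T] by (intro mult_left_mono) auto
    also have "\<dots> \<le> C * a * (l * Y powr (- (1 / s)))"
      using a C1 Y by (intro mult_left_mono mult_right_mono) auto
    also have "\<dots> = \<epsilon> / 2 * ((2 * C * l * a / \<epsilon>) * Y powr (- (1 / s)))"
      using \<epsilon> by simp
    also have "\<dots> \<le> \<epsilon> / 2 * 1"
      using a s z \<epsilon> C1 l Ypos by (intro mult_left_mono mult_powr_minus_inverse_le_one) auto
    finally show ?thesis
      by simp
  qed
  have "nsgd_bound \<eta> p \<Delta> L \<sigma> T \<le> soft_rate C 1 p \<Delta> L \<sigma> T"
    unfolding C by (rule nsgd_bound_le_soft_rate[OF p \<eta> nonneg T3])
  also have "\<dots> = C * ln (real T) * ((\<Delta> + L) * real T powr (- (1 / 4)))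
      + C * ln (real T) * (\<sigma> * real T powr (- (1 / r)))"
    unfolding soft_rate_def rinv by (simp add: distrib_left)
  also have "\<dots> \<le> \<epsilon> / 2 + \<epsilon> / 2"
    using nonneg Y Y1 Y2 Y4 r4 C1 l \<epsilon>
    by (intro add_mono * ) (auto simp: powr_numeral)
  finally show ?thesis
    by simp
qed

text \<open>The threshold is \<open>Y = c * l ^ k * B\<close> with
  \<open>l = ln (1 / \<epsilon>)\<close> and \<open>B\<close> the bracket in
  \<open>soft_complexity\<close>. Both \<open>c\<close> and \<open>k\<close> are built from \<eta>
  and \<open>p\<close> alone; the problem data enter only through how small \<epsilon> must
  be.\<close>

lemma nsgd_bound_complexity:
  assumes p: "1 < p" "p \<le> 2" and \<eta>: "0 < \<eta>"
  obtains C k where "\<And>\<Delta> L \<sigma>. \<lbrakk>0 < \<Delta>; 0 \<le> L; 0 \<le> \<sigma>\<rbrakk> \<Longrightarrow> \<exists>\<epsilon>0>0. \<forall>\<epsilon>. 0 < \<epsilon> \<and> \<epsilon> < \<epsilon>0 \<longrightarrow>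
    (\<exists>N\<ge>3. real N \<le> soft_complexity C k p \<Delta> L \<sigma> \<epsilon> \<and> (\<forall>T\<ge>N. nsgd_bound \<eta> p \<Delta> L \<sigma> T \<le> \<epsilon>))"
proof -
  define r where "r = 2 * p / (p - 1)"
  define C0 where "C0 = 1 / \<eta> + 120 * \<eta> + 120"
  \<comment> \<open>\<open>Y\<close> is at most \<open>c * G * l ^ k\<close> times
    \<open>(1 / \<epsilon>) powr r\<close>; one further factor \<open>1 / \<epsilon>\<close> absorbs
    \<open>c * G * l ^ k\<close> for small \<epsilon>, whence
    \<open>ln Y \<le> (r + 1) * l\<close>.\<close>
  define m where "m = r + 1"
  define A where "A = 4 * C0 * m"
  define c where "c = A powr r"
  \<comment> \<open>An integer exponent for which \<open>l ^ k\<close> dominates both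
    \<open>l ^ 4\<close> and \<open>l powr r\<close>.\<close>
  define k where "k = nat \<lceil>r\<rceil>"
  have r: "4 \<le> r"
    using p by (simp add: r_def field_simps)
  have k: "r \<le> real k" "4 \<le> k"
    using r by (auto simp: k_def) linarith
  have C0: "1 \<le> C0"
    using \<eta> by (simp add: C0_def)
  have A: "1 \<le> A"
    using mult_mono[of 1 "2 * C0" 1 m] C0 r by (simp add: A_def m_def)
  have c: "A ^ 4 \<le> c" "1 \<le> c"
    using A r powr_mono[of 4 r A] by (auto simp: c_def powr_numeral ge_one_powr_ge_zero)
  show thesis
  proof (rule that[of "2 * c" k])
    fix \<Delta> L \<sigma> :: real
    assume nonneg: "0 < \<Delta>" "0 \<le> L" "0 \<le> \<sigma>"
    define G where "G = \<Delta> ^ 4 + L ^ 4 + \<sigma> powr r"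
    have ev_l: "\<forall>\<^sub>F \<epsilon> in at_right 0. 1 \<le> ln (1 / \<epsilon> :: real)"
      using ln_inverse_at_top by (simp add: filterlim_at_top)
    have "((\<lambda>\<epsilon>::real. c * G * (ln (1 / \<epsilon>) ^ k * \<epsilon>)) \<longlongrightarrow> c * G * 0) (at_right 0)"
      by (intro tendsto_mult_left ln_power_mult_tendsto_0)
    then have ev_small: "\<forall>\<^sub>F \<epsilon> in at_right 0. c * G * (ln (1 / \<epsilon>) ^ k * \<epsilon>) < 1"
      by (rule order_tendstoD) simp
    \<comment> \<open>Here \<open>0 < \<Delta>\<close> enters: it forces \<open>B\<close> to
      infinity, and so \<open>exp r \<le> Y\<close>, even if \<open>L\<close> and \<sigma>
      vanish.\<close>
    have ev_large: "\<forall>\<^sub>F \<epsilon> in at_right 0. exp r / \<Delta> ^ 4 \<le> inverse \<epsilon>"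
      using filterlim_inverse_at_top_right by (simp add: filterlim_at_top)
    have "\<forall>\<^sub>F \<epsilon> in at_right 0. \<exists>N\<ge>3. real N \<le> soft_complexity (2 * c) k p \<Delta> L \<sigma> \<epsilon> \<and>
      (\<forall>T\<ge>N. nsgd_bound \<eta> p \<Delta> L \<sigma> T \<le> \<epsilon>)"
      using ev_l ev_small ev_large eventually_at_right_less[of 0]
    proof eventually_elim
      fix \<epsilon> :: real
      assume l1: "1 \<le> ln (1 / \<epsilon>)" and small: "c * G * (ln (1 / \<epsilon>) ^ k * \<epsilon>) < 1"
        and large: "exp r / \<Delta> ^ 4 \<le> inverse \<epsilon>" and \<epsilon>: "0 < \<epsilon>"
      define l where "l = ln (1 / \<epsilon>)"
      define B where "B = (\<Delta> ^ 4 + L ^ 4) / \<epsilon> ^ 4 + (\<sigma> / \<epsilon>) powr r"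
      define Y where "Y = c * l ^ k * B"
      have l: "1 \<le> l"
        using l1 by (simp add: l_def)
      have \<epsilon>1: "1 \<le> 1 / \<epsilon>"
        using l1 \<epsilon> by (metis divide_pos_pos ln_ge_zero_iff order_trans zero_le_one zero_less_one)
      have lk: "1 \<le> l ^ k" "l ^ 4 \<le> l ^ k" "l powr r \<le> l ^ k"
        using l k powr_mono[of r "real k" l] by (auto intro: power_increasing simp: powr_realpow)
      have B: "\<Delta> ^ 4 / \<epsilon> ^ 4 \<le> B" "0 \<le> B" "(\<Delta> ^ 4 + L ^ 4) / \<epsilon> ^ 4 \<le> B" "(\<sigma> / \<epsilon>) powr r \<le> B"
        using nonneg \<epsilon> by (auto simp: B_def add_divide_distrib)
      have clk: "1 \<le> c * l ^ k"
        using mult_mono[of 1 c 1 "l ^ k"] c lk by simp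
      have Y_large: "exp r \<le> Y"
      proof -
        have "exp r \<le> \<Delta> ^ 4 * (1 / \<epsilon>)"
          using large nonneg by (simp add: field_simps)
        also have "\<dots> \<le> \<Delta> ^ 4 * (1 / \<epsilon>) ^ 4"
          using \<epsilon>1 by (intro mult_left_mono self_le_power) auto
        also have "\<dots> \<le> B"
          using B(1) by (simp add: power_divide)
        also have "\<dots> \<le> Y"
          using mult_right_mono[OF clk B(2)] by (simp add: Y_def)
        finally show ?thesis .
      qed
      have "exp 4 \<le> exp r"
        using r by simp
      then have Y5: "5 \<le> Y"
        using Y_large exp_ge_add_one_self[of 4] by linarith
      have lnY: "ln Y \<le> m * l"
      proof -
        have "(1 / \<epsilon>) ^ 4 \<le> (1 / \<epsilon>) powr r"
          using powr_mono[OF r \<epsilon>1] \<epsilon> by (simp add: powr_numeral)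
        then have "(\<Delta> ^ 4 + L ^ 4) * (1 / \<epsilon>) ^ 4 \<le> (\<Delta> ^ 4 + L ^ 4) * (1 / \<epsilon>) powr r"
          by (intro mult_left_mono) auto
        moreover have "(\<sigma> / \<epsilon>) powr r = \<sigma> powr r * (1 / \<epsilon>) powr r"
          using nonneg \<epsilon> by (simp flip: powr_mult)
        ultimately have "B \<le> G * (1 / \<epsilon>) powr r"
          by (simp add: B_def G_def power_divide distrib_right)
        then have "Y \<le> c * l ^ k * (G * (1 / \<epsilon>) powr r)"
          unfolding Y_def using clk by (intro mult_left_mono) auto
        also have "\<dots> = (c * G * (l ^ k * \<epsilon>)) * ((1 / \<epsilon>) powr r * (1 / \<epsilon>))"
          using \<epsilon> by simp
        also have "\<dots> \<le> 1 * ((1 / \<epsilon>) powr r * (1 / \<epsilon>))"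
          using small \<epsilon> by (intro mult_right_mono) (auto simp: l_def)
        also have "\<dots> = (1 / \<epsilon>) powr m"
          using \<epsilon> by (simp add: m_def powr_add)
        finally have "ln Y \<le> ln ((1 / \<epsilon>) powr m)"
          using Y5 \<epsilon> by (subst ln_le_cancel_iff) auto
        then show ?thesis
          using \<epsilon> by (simp add: l_def ln_powr)
      qed
      have bound: "nsgd_bound \<eta> p \<Delta> L \<sigma> T \<le> \<epsilon>" if "Y \<le> real T" for T
      proof (rule nsgd_bound_le_of_large[OF p \<eta> _ _ _ r_def C0_def _ Y_large lnY that \<epsilon>])
        \<comment> \<open>\<open>A\<close> is twice the factor \<open>2 * C0 * m\<close>; the spare
          \<open>1 / 16\<close> outweighs the 8 of \<open>add_power4_le\<close>.\<close>
        have "(2 * C0 * (m * l) * (\<Delta> + L) / \<epsilon>) ^ 4 = (A * l / 2 * ((\<Delta> + L) / \<epsilon>)) ^ 4"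
          by (simp add: A_def mult_ac)
        also have "\<dots> = A ^ 4 * l ^ 4 * ((\<Delta> + L) ^ 4 / \<epsilon> ^ 4 / 16)"
          by (simp add: power_mult_distrib power_divide)
        also have "\<dots> \<le> c * l ^ k * B"
        proof (intro mult_mono)
          have "w / 16 \<le> u + v" if "w \<le> 8 * (u + v)" "0 \<le> u" "0 \<le> v" for u v w :: real
            using that by simp
          from this[OF add_power4_le] have "(\<Delta> + L) ^ 4 / 16 \<le> \<Delta> ^ 4 + L ^ 4"
            by simp
          from divide_right_mono[OF this, of "\<epsilon> ^ 4"]
          show "(\<Delta> + L) ^ 4 / \<epsilon> ^ 4 / 16 \<le> B"
            using B(3) \<epsilon> by (simp add: field_simps)
        qed (use c lk B l in auto)
        finally show "(2 * C0 * (m * l) * (\<Delta> + L) / \<epsilon>) ^ 4 \<le> Y"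
          by (simp add: Y_def)
        have "(2 * C0 * (m * l) * \<sigma> / \<epsilon>) powr r \<le> (A * l * (\<sigma> / \<epsilon>)) powr r"
          using C0 r l nonneg \<epsilon> by (intro powr_mono2) (auto simp: A_def m_def divide_simps)
        also have "\<dots> = c * l powr r * (\<sigma> / \<epsilon>) powr r"
          using A l nonneg \<epsilon> by (simp add: powr_mult powr_divide c_def)
        also have "\<dots> \<le> c * l ^ k * B"
          using lk B c by (intro mult_mono) auto
        finally show "(2 * C0 * (m * l) * \<sigma> / \<epsilon>) powr r \<le> Y"
          by (simp add: Y_def)
      qed (use nonneg l r m_def in auto)
      show "\<exists>N\<ge>3. real N \<le> soft_complexity (2 * c) k p \<Delta> L \<sigma> \<epsilon> \<and>
        (\<forall>T\<ge>N. nsgd_bound \<eta> p \<Delta> L \<sigma> T \<le> \<epsilon>)"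
      proof (intro exI[of _ "nat \<lceil>Y\<rceil>"] conjI allI impI)
        show "3 \<le> nat \<lceil>Y\<rceil>"
          using Y5 by linarith
        \<comment> \<open>Rounding up is the source of the 2 in the witness
          \<open>2 * c\<close>.\<close>
        have "real (nat \<lceil>Y\<rceil>) \<le> 2 * Y"
          using Y5 by linarith
        then show "real (nat \<lceil>Y\<rceil>) \<le> soft_complexity (2 * c) k p \<Delta> L \<sigma> \<epsilon>"
          by (simp add: soft_complexity_def Y_def B_def l_def r_def)
        show "nsgd_bound \<eta> p \<Delta> L \<sigma> T \<le> \<epsilon>" if "nat \<lceil>Y\<rceil> \<le> T" for T
          using that by (intro bound) linarith
      qed
    qed
    then show "\<exists>\<epsilon>0>0. \<forall>\<epsilon>. 0 < \<epsilon> \<and> \<epsilon> < \<epsilon>0 \<longrightarrow>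
      (\<exists>N\<ge>3. real N \<le> soft_complexity (2 * c) k p \<Delta> L \<sigma> \<epsilon> \<and> (\<forall>T\<ge>N. nsgd_bound \<eta> p \<Delta> L \<sigma> T \<le> \<epsilon>))"
      by (auto simp: eventually_at_right_field)
  qed
qed

lemma avg_grad_norm_le_nsgd_bound:
  assumes "0 < \<eta>" "1 < p" "p \<le> 2" and "nsgd_run \<eta> p \<Delta> L \<sigma> M D \<xi> df F Fstar x1 x g" and "3 \<le> T"
  shows "avg_grad_norm M F x T \<le> nsgd_bound \<eta> p \<Delta> L \<sigma> T"
  using assms by (intro nsgd.avg_grad_norm_le nsgd.intro)

theorem corollary18:
  fixes \<eta> p :: real
  assumes "\<eta> > 0" and "1 < p" and "p \<le> 2"
  shows
    "(\<forall>\<Delta>\<^sub>1 L \<sigma> (M :: 'w measure) (D :: 'xi measure) \<xi> df (F :: 'a::euclidean_space \<Rightarrow> real) Fstar x1 x g.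
        \<forall>T\<ge>3. nsgd_run \<eta> p \<Delta>\<^sub>1 L \<sigma> M D \<xi> df F Fstar x1 x g \<longrightarrow>
          (\<forall>t\<in>{1..T}. integrable M (\<lambda>\<omega>. norm (gradient F (x t \<omega>)))) \<and>
          avg_grad_norm M F x T \<le> nsgd_bound \<eta> p \<Delta>\<^sub>1 L \<sigma> T)
     \<and>
     (\<exists>C k. \<forall>\<Delta>\<^sub>1\<ge>0. \<forall>L\<ge>0. \<forall>\<sigma>\<ge>0. \<exists>T0. \<forall>T\<ge>T0.
        nsgd_bound \<eta> p \<Delta>\<^sub>1 L \<sigma> T \<le> soft_rate C k p \<Delta>\<^sub>1 L \<sigma> T \<and>
        (\<forall>(M :: 'w measure) (D :: 'xi measure) \<xi> df (F :: 'a \<Rightarrow> real) Fstar x1 x g.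
           nsgd_run \<eta> p \<Delta>\<^sub>1 L \<sigma> M D \<xi> df F Fstar x1 x g \<longrightarrow>
             avg_grad_norm M F x T \<le> soft_rate C k p \<Delta>\<^sub>1 L \<sigma> T))
     \<and>
     (\<exists>C k. \<forall>\<Delta>\<^sub>1>0. \<forall>L\<ge>0. \<forall>\<sigma>\<ge>0. \<exists>\<epsilon>0>0. \<forall>\<epsilon>. 0 < \<epsilon> \<and> \<epsilon> < \<epsilon>0 \<longrightarrow>
        (\<exists>N\<ge>1. real N \<le> soft_complexity C k p \<Delta>\<^sub>1 L \<sigma> \<epsilon> \<and>
          (\<forall>T\<ge>N.
            nsgd_bound \<eta> p \<Delta>\<^sub>1 L \<sigma> T \<le> \<epsilon> \<and>
            (\<forall>(M :: 'w measure) (D :: 'xi measure) \<xi> df (F :: 'a \<Rightarrow> real) Fstar x1 x g.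
               nsgd_run \<eta> p \<Delta>\<^sub>1 L \<sigma> M D \<xi> df F Fstar x1 x g \<longrightarrow>
                 avg_grad_norm M F x T \<le> \<epsilon>))))"
proof (intro conjI)
  note bound = avg_grad_norm_le_nsgd_bound[OF assms]
  show "\<forall>\<Delta>\<^sub>1 L \<sigma> (M :: 'w measure) (D :: 'xi measure) \<xi> df (F :: 'a \<Rightarrow> real) Fstar x1 x g.
        \<forall>T\<ge>3. nsgd_run \<eta> p \<Delta>\<^sub>1 L \<sigma> M D \<xi> df F Fstar x1 x g \<longrightarrow>
          (\<forall>t\<in>{1..T}. integrable M (\<lambda>\<omega>. norm (gradient F (x t \<omega>)))) \<and>
          avg_grad_norm M F x T \<le> nsgd_bound \<eta> p \<Delta>\<^sub>1 L \<sigma> T"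
    by (intro allI impI conjI ballI bound)
      (auto intro: nsgd.integrable_gradient[OF nsgd.intro[OF assms]])
  show "\<exists>C k. \<forall>\<Delta>\<^sub>1\<ge>0. \<forall>L\<ge>0. \<forall>\<sigma>\<ge>0. \<exists>T0. \<forall>T\<ge>T0.
        nsgd_bound \<eta> p \<Delta>\<^sub>1 L \<sigma> T \<le> soft_rate C k p \<Delta>\<^sub>1 L \<sigma> T \<and>
        (\<forall>(M :: 'w measure) (D :: 'xi measure) \<xi> df (F :: 'a \<Rightarrow> real) Fstar x1 x g.
           nsgd_run \<eta> p \<Delta>\<^sub>1 L \<sigma> M D \<xi> df F Fstar x1 x g \<longrightarrow>
             avg_grad_norm M F x T \<le> soft_rate C k p \<Delta>\<^sub>1 L \<sigma> T)"
    \<comment> \<open>Witnesses: \<open>1 / \<eta> + 120 * \<eta> + 120\<close> for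
      \<open>C\<close>, 1 for \<open>k\<close>, and 3 for \<open>T0\<close>.\<close>
    using nsgd_bound_le_soft_rate[OF assms(2,3,1)] bound by (meson order_trans)
  obtain C k where Ck: "\<And>\<Delta> L \<sigma>. \<lbrakk>0 < \<Delta>; 0 \<le> L; 0 \<le> \<sigma>\<rbrakk> \<Longrightarrow> \<exists>\<epsilon>0>0. \<forall>\<epsilon>. 0 < \<epsilon> \<and> \<epsilon> < \<epsilon>0 \<longrightarrow>
    (\<exists>N\<ge>3. real N \<le> soft_complexity C k p \<Delta> L \<sigma> \<epsilon> \<and> (\<forall>T\<ge>N. nsgd_bound \<eta> p \<Delta> L \<sigma> T \<le> \<epsilon>))"
    using nsgd_bound_complexity[OF assms(2,3,1)] by blast
  show "\<exists>C k. \<forall>\<Delta>\<^sub>1>0. \<forall>L\<ge>0. \<forall>\<sigma>\<ge>0. \<exists>\<epsilon>0>0. \<forall>\<epsilon>. 0 < \<epsilon> \<and> \<epsilon> < \<epsilon>0 \<longrightarrow>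
        (\<exists>N\<ge>1. real N \<le> soft_complexity C k p \<Delta>\<^sub>1 L \<sigma> \<epsilon> \<and>
          (\<forall>T\<ge>N.
            nsgd_bound \<eta> p \<Delta>\<^sub>1 L \<sigma> T \<le> \<epsilon> \<and>
            (\<forall>(M :: 'w measure) (D :: 'xi measure) \<xi> df (F :: 'a \<Rightarrow> real) Fstar x1 x g.
               nsgd_run \<eta> p \<Delta>\<^sub>1 L \<sigma> M D \<xi> df F Fstar x1 x g \<longrightarrow>
                 avg_grad_norm M F x T \<le> \<epsilon>)))"
  proof (rule exI[of _ C], rule exI[of _ k], intro allI impI)
    fix \<Delta> L \<sigma> :: real
    assume "0 < \<Delta>" "0 \<le> L" "0 \<le> \<sigma>"
    from Ck[OF this] obtain \<epsilon>0 where "0 < \<epsilon>0" and \<epsilon>0: "\<And>\<epsilon>. \<lbrakk>0 < \<epsilon>; \<epsilon> < \<epsilon>0\<rbrakk> \<Longrightarrow>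
      \<exists>N\<ge>3. real N \<le> soft_complexity C k p \<Delta> L \<sigma> \<epsilon> \<and> (\<forall>T\<ge>N. nsgd_bound \<eta> p \<Delta> L \<sigma> T \<le> \<epsilon>)"
      by blast
    show "\<exists>\<epsilon>0>0. \<forall>\<epsilon>. 0 < \<epsilon> \<and> \<epsilon> < \<epsilon>0 \<longrightarrow>
        (\<exists>N\<ge>1. real N \<le> soft_complexity C k p \<Delta> L \<sigma> \<epsilon> \<and>
          (\<forall>T\<ge>N.
            nsgd_bound \<eta> p \<Delta> L \<sigma> T \<le> \<epsilon> \<and>
            (\<forall>(M :: 'w measure) (D :: 'xi measure) \<xi> df (F :: 'a \<Rightarrow> real) Fstar x1 x g.
               nsgd_run \<eta> p \<Delta> L \<sigma> M D \<xi> df F Fstar x1 x g \<longrightarrow>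
                 avg_grad_norm M F x T \<le> \<epsilon>)))"
    proof (intro exI[of _ \<epsilon>0] conjI allI impI)
      fix \<epsilon> assume "0 < \<epsilon> \<and> \<epsilon> < \<epsilon>0"
      then obtain N where N: "3 \<le> N" "real N \<le> soft_complexity C k p \<Delta> L \<sigma> \<epsilon>"
        "\<And>T. N \<le> T \<Longrightarrow> nsgd_bound \<eta> p \<Delta> L \<sigma> T \<le> \<epsilon>"
        using \<epsilon>0 by blast
      have "avg_grad_norm M F x T \<le> \<epsilon>"
        if "N \<le> T" "nsgd_run \<eta> p \<Delta> L \<sigma> M D \<xi> df F Fstar x1 x g"
        for T and M :: "'w measure" and D :: "'xi measure" and \<xi> df and F :: "'a \<Rightarrow> real" and Fstar x1 x g
        using bound[OF that(2)] N(1) N(3)[OF that(1)] that(1) by (meson order_trans)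
      then show "\<exists>N\<ge>1. real N \<le> soft_complexity C k p \<Delta> L \<sigma> \<epsilon> \<and>
          (\<forall>T\<ge>N.
            nsgd_bound \<eta> p \<Delta> L \<sigma> T \<le> \<epsilon> \<and>
            (\<forall>(M :: 'w measure) (D :: 'xi measure) \<xi> df (F :: 'a \<Rightarrow> real) Fstar x1 x g.
               nsgd_run \<eta> p \<Delta> L \<sigma> M D \<xi> df F Fstar x1 x g \<longrightarrow>
                 avg_grad_norm M F x T \<le> \<epsilon>))"
        using N by (intro exI[of _ N]) auto
    qed (rule \<open>0 < \<epsilon>0\<close>)
  qed
qed

end
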